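(* For each $\omega\in(0,2)$ let $\vec{x}(\omega)=\lim_{n\to\infty}\vec{x}^{(n)}$, where $\vec{x}^{(n+1)}=\widehat{\mathcal{B}}^{\omega}\vec{x}^{(n)}+\vec{\mathbf{b}}^{\omega}$ with $\vec{x}^{(0)}\in\mathcal{R}(\mathcal{S}^* )$ (this limit exists and does not depend on $\vec{x}^{(0)}$). Then $$\lim_{\omega\to 0}\vec{x}(\omega)=\vec{x}^{LS},$$ where $\vec{x}^{LS}$ minimizes the functional $$\vec{z}\mapsto\big\langle \mathcal{D}^{-1}\mathcal{W}(\vec{\mathbf{b}}-\mathcal{S}\vec{z}),\,\vec{\mathbf{b}}-\mathcal{S}\vec{z}\big\rangle .$$ That is, the limit as $\omega\to0$ (from within $(0,2)$) exists and is a minimizer of this functional over $\mathbb{C}^d$.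
   Context: A finite tree with root $r$ and leaves $\ell_1,\dots,\ell_t$ (set of leaves $\mathcal{L}$) is given. Each node $v$ carries a nonzero vector $\vec{a}_v\in\mathbb{C}^d$ and a scalar $b_v\in\mathbb{C}$; no consistency of the system of equations $\vec{a}_v\cdot\vec{x}=b_v$ is assumed. $S_v:\mathbb{C}^d\to\mathbb{C}$ is $S_v\vec{z}=\vec{a}_v\cdot\vec{z}=\sum_k a_{v,k}z_k$. $\mathcal{R}(\cdot)$ denotes range, and $\langle\cdot,\cdot\rangle$ is the standard sesquilinear inner product. Each edge between a node $v$ and a child $u$ of $v$ carries a weight $w(u,v)>0$, and for each non-leaf $v$ the weights over its children sum to $1$. For a leaf $\ell$, $w(\ell,r)$ is the product of the edge weights along the path from $r$ to $\ell$. The nodes on this path are $r=(\ell,1),\dots,(\ell,p_\ell)=\ell$, with $S_{\ell,j}$, $b_{\ell,j}$ the corresponding $S_v$, $b_v$. For each leaf $\ell$: $\mathcal{S}_\ell:\mathbb{C}^d\to\mathbb{C}^{p_\ell}$ is the column of $S_{\ell,1},\dots,S_{\ell,p_\ell}$; $\vec{b}_\ell=(b_{\ell,1},\dots,b_{\ell,p_\ell})^T$; $\mathcal{D}_\ell$ is the diagonal matrix with entries $S_{\ell,j}S_{\ell,j}^*$; $\mathcal{L}_\ell$ is the strictly lower triangular matrix with $(i,j)$ entry $S_{\ell,i}S_{\ell,j}^*$ for $i>j$. Let $\mathcal{S}$ be the column of $\mathcal{S}_{\ell_1},\dots,\mathcal{S}_{\ell_t}$, $\vec{\mathbf{b}}$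 the column of $\vec{b}_{\ell_1},\dots,\vec{b}_{\ell_t}$, and let $\mathcal{D}$, $\widetilde{\mathcal{L}}$, $\mathcal{W}$ be the block diagonal matrices with blocks $\mathcal{D}_{\ell_i}$, $\mathcal{L}_{\ell_i}$, $w(\ell_i,r)I_{p_{\ell_i}}$ respectively. Set $$\mathcal{B}^\omega=I-\omega\mathcal{S}^*(\mathcal{D}+\omega\widetilde{\mathcal{L}})^{-1}\mathcal{W}\mathcal{S},\qquad \vec{\mathbf{b}}^\omega=\omega\mathcal{S}^*(\mathcal{D}+\omega\widetilde{\mathcal{L}})^{-1}\mathcal{W}\vec{\mathbf{b}}.$$ $\mathcal{R}(\mathcal{S}^* )$ is invariant under $\mathcal{B}^\omega$, and $\widehat{\mathcal{B}}^\omega$ is the restriction of $\mathcal{B}^\omega$ to $\mathcal{R}(\mathcal{S}^* )$. *)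

theory Defs
  imports
    "Jordan_Normal_Form.Gauss_Jordan_Elimination"
    "Jordan_Normal_Form.Schur_Decomposition"
    "HOL-Library.FuncSet"
begin

text \<open>
  Finite rooted trees. \<open>Node v [(c\<^sub>1, t\<^sub>1), \<dots>, (c\<^sub>m, t\<^sub>m)]\<close> has root \<open>v\<close>, and \<open>c\<^sub>i\<close> is the
  weight of the edge from \<open>v\<close> to the root of \<open>t\<^sub>i\<close>. The vectors and scalars carried by the
  nodes are functions of the node names, which need not be distinct; leaves are
  identified by position, never by name.
\<close>

datatype 'v wtree = Node 'v "(real \<times> 'v wtree) list"

fun normalized_weights :: "'v wtree \<Rightarrow> bool" where
  "normalized_weights (Node v ts) \<longleftrightarrow>
     (\<forall>(c, t) \<in> set ts. 0 < c \<and> normalized_weights t) \<and>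
     (ts \<noteq> [] \<longrightarrow> sum_list (map fst ts) = 1)"

text \<open>
  One entry per leaf, from left to right: the edge weights and the nodes on the path from
  the root to that leaf.
\<close>

fun leaf_paths :: "'v wtree \<Rightarrow> (real list \<times> 'v list) list" where
  "leaf_paths (Node v ts) =
     (if ts = [] then [([], [v])]
      else concat (map (\<lambda>(c, t). map (\<lambda>(ws, vs). (c # ws, v # vs)) (leaf_paths t)) ts))"

text \<open>
  Since \<open>S\<^sub>v z = \<Sum>\<^sub>k a\<^sub>v\<^sub>,\<^sub>k z\<^sub>k\<close> without conjugation, \<open>S\<^sub>v\<close> is the row \<open>a\<^sub>v\<close> and the scalar
  \<open>S\<^sub>u S\<^sub>v\<^sup>*\<close> is \<open>a u \<bullet>c a v\<close>.
\<close>

definition D_leaf :: "('v \<Rightarrow> complex vec) \<Rightarrow> 'v list \<Rightarrow> complex mat" where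
  "D_leaf a vs = mat (length vs) (length vs)
     (\<lambda>(i, j). if i = j then a (vs ! i) \<bullet>c a (vs ! j) else 0)"

definition L_leaf :: "('v \<Rightarrow> complex vec) \<Rightarrow> 'v list \<Rightarrow> complex mat" where
  "L_leaf a vs = mat (length vs) (length vs)
     (\<lambda>(i, j). if j < i then a (vs ! i) \<bullet>c a (vs ! j) else 0)"

definition S_mat :: "nat \<Rightarrow> ('v \<Rightarrow> complex vec) \<Rightarrow> 'v wtree \<Rightarrow> complex mat" where
  "S_mat d a T = mat_of_rows d (concat (map (\<lambda>(ws, vs). map a vs) (leaf_paths T)))"

definition b_vec :: "('v \<Rightarrow> complex) \<Rightarrow> 'v wtree \<Rightarrow> complex vec" where
  "b_vec b T = vec_of_list (concat (map (\<lambda>(ws, vs). map b vs) (leaf_paths T)))"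

definition D_mat :: "('v \<Rightarrow> complex vec) \<Rightarrow> 'v wtree \<Rightarrow> complex mat" where
  "D_mat a T = diag_block_mat (map (\<lambda>(ws, vs). D_leaf a vs) (leaf_paths T))"

definition L_mat :: "('v \<Rightarrow> complex vec) \<Rightarrow> 'v wtree \<Rightarrow> complex mat" where
  "L_mat a T = diag_block_mat (map (\<lambda>(ws, vs). L_leaf a vs) (leaf_paths T))"

definition W_mat :: "'v wtree \<Rightarrow> complex mat" where
  "W_mat T = diag_block_mat
     (map (\<lambda>(ws, vs). complex_of_real (prod_list ws) \<cdot>\<^sub>m 1\<^sub>m (length vs)) (leaf_paths T))"

text \<open>Only applied to invertible matrices; \<open>mat_inverse\<close> returns \<open>None\<close> on singular ones.\<close>

definition mat_inv :: "complex mat \<Rightarrow> complex mat" where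
  "mat_inv A = the (mat_inverse A)"

definition B_mat :: "nat \<Rightarrow> ('v \<Rightarrow> complex vec) \<Rightarrow> 'v wtree \<Rightarrow> real \<Rightarrow> complex mat" where
  "B_mat d a T \<omega> = 1\<^sub>m d - complex_of_real \<omega> \<cdot>\<^sub>m
     (mat_adjoint (S_mat d a T) * mat_inv (D_mat a T + complex_of_real \<omega> \<cdot>\<^sub>m L_mat a T)
       * W_mat T * S_mat d a T)"

definition b_relax ::
    "nat \<Rightarrow> ('v \<Rightarrow> complex vec) \<Rightarrow> ('v \<Rightarrow> complex) \<Rightarrow> 'v wtree \<Rightarrow> real \<Rightarrow> complex vec" where
  "b_relax d a b T \<omega> = complex_of_real \<omega> \<cdot>\<^sub>v
     ((mat_adjoint (S_mat d a T) * mat_inv (D_mat a T + complex_of_real \<omega> \<cdot>\<^sub>m L_mat a T)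
       * W_mat T) *\<^sub>v b_vec b T)"

definition range_S_adj :: "nat \<Rightarrow> ('v \<Rightarrow> complex vec) \<Rightarrow> 'v wtree \<Rightarrow> complex vec set" where
  "range_S_adj d a T =
     (\<lambda>y. mat_adjoint (S_mat d a T) *\<^sub>v y) ` carrier_vec (dim_row (S_mat d a T))"

definition B_hat ::
    "nat \<Rightarrow> ('v \<Rightarrow> complex vec) \<Rightarrow> 'v wtree \<Rightarrow> real \<Rightarrow> complex vec \<Rightarrow> complex vec" where
  "B_hat d a T \<omega> = restrict (\<lambda>x. B_mat d a T \<omega> *\<^sub>v x) (range_S_adj d a T)"

primrec kaczmarz_iter ::
    "nat \<Rightarrow> ('v \<Rightarrow> complex vec) \<Rightarrow> ('v \<Rightarrow> complex) \<Rightarrow> 'v wtree \<Rightarrow> real \<Rightarrow> complex vec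
      \<Rightarrow> nat \<Rightarrow> complex vec" where
  "kaczmarz_iter d a b T \<omega> x0 0 = x0"
| "kaczmarz_iter d a b T \<omega> x0 (Suc n) =
     B_hat d a T \<omega> (kaczmarz_iter d a b T \<omega> x0 n) + b_relax d a b T \<omega>"

text \<open>
  The quadratic form is real-valued because \<open>D\<^sup>-\<^sup>1 W\<close> is a real diagonal matrix; \<open>Re\<close> only
  changes its type.
\<close>

definition ls_functional ::
    "nat \<Rightarrow> ('v \<Rightarrow> complex vec) \<Rightarrow> ('v \<Rightarrow> complex) \<Rightarrow> 'v wtree \<Rightarrow> complex vec \<Rightarrow> real" where
  "ls_functional d a b T z =
     (let e = b_vec b T - S_mat d a T *\<^sub>v z
      in Re (((mat_inv (D_mat a T) * W_mat T) *\<^sub>v e) \<bullet>c e))"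

text \<open>Type \<^typ>\<open>complex vec\<close> carries no topology; this is convergence in \<open>\<complex>\<^sup>d\<close>, \<open>d = dim_vec l\<close>.\<close>

definition vec_tendsto :: "('i \<Rightarrow> complex vec) \<Rightarrow> complex vec \<Rightarrow> 'i filter \<Rightarrow> bool" where
  "vec_tendsto f l F \<longleftrightarrow>
     (\<forall>\<^sub>F i in F. dim_vec (f i) = dim_vec l) \<and>
     (\<forall>k < dim_vec l. ((\<lambda>i. vec_index (f i) k) \<longlongrightarrow> vec_index l k) F)"

end

theory Submission
  imports Defs "HOL-Analysis.L2_Norm" "HOL-Analysis.Convex"
begin

text \<open>
  If \<open>(D + \<omega> L) v = S x\<close>, Jensen's inequality over the leaf weights and \<open>S\<^sub>\<ell> S\<^sub>\<ell>\<^sup>* = D\<^sub>\<ell> + L\<^sub>\<ell> + L\<^sub>\<ell>\<^sup>*\<close>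
  give \<open>\<parallel>x - \<omega> S\<^sup>* W v\<parallel>\<^sup>2 \<le> \<parallel>x\<parallel>\<^sup>2 - \<omega> (2 - \<omega>) \<langle>W D v, v\<rangle>\<close>. On the range of \<open>S\<^sup>*\<close> the last form
  dominates a multiple of \<open>\<parallel>x\<parallel>\<^sup>2\<close> that is uniform in \<open>\<omega>\<close>, so the iteration contracts with
  factor \<open>1 - \<omega> (2 - \<omega>) c\<close>. Let \<open>x\<^sub>L\<^sub>S\<close> in that range solve the weighted normal equations
  \<open>S\<^sup>* W D\<^sup>-\<^sup>1 (b - S x\<^sub>L\<^sub>S) = 0\<close>. One step started at \<open>x\<^sub>L\<^sub>S\<close> moves it by \<open>\<omega> g\<^sub>\<omega>\<close> with
  \<open>g\<^sub>\<omega> = S\<^sup>* W (D + \<omega> L)\<^sup>-\<^sup>1 (b - S x\<^sub>L\<^sub>S)\<close>, hence the limit lies within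
  \<open>\<parallel>g\<^sub>\<omega>\<parallel> / ((2 - \<omega>) c)\<close> of \<open>x\<^sub>L\<^sub>S\<close>, and \<open>g\<^sub>\<omega> \<rightarrow> 0\<close> by the normal equations.
\<close>


subsection \<open>Coordinate functions\<close>

definition nsq :: "nat \<Rightarrow> (nat \<Rightarrow> complex) \<Rightarrow> real" where
  "nsq n x = (\<Sum>k<n. (cmod (x k))\<^sup>2)"

definition ip :: "nat \<Rightarrow> (nat \<Rightarrow> complex) \<Rightarrow> (nat \<Rightarrow> complex) \<Rightarrow> complex" where
  "ip n x y = (\<Sum>k<n. x k * cnj (y k))"

lemma nsq_nonneg: "0 \<le> nsq n x"
  by (simp add: nsq_def sum_nonneg)

lemma ip_self: "ip n x x = of_real (nsq n x)"
  by (simp add: ip_def nsq_def complex_norm_square del: of_real_power)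

lemma nsq_eq_Re_ip: "nsq n x = Re (ip n x x)"
  by (simp add: ip_self)

lemma nsq_cong: "(\<And>k. k < n \<Longrightarrow> x k = y k) \<Longrightarrow> nsq n x = nsq n y"
  by (simp add: nsq_def)

lemma nsq_diff_scaled:
  "nsq n (\<lambda>k. x k - of_real c * z k) = nsq n x - 2 * c * Re (ip n x z) + c\<^sup>2 * nsq n z"
proof -
  have "(cmod (x k - of_real c * z k))\<^sup>2 =
      (cmod (x k))\<^sup>2 - 2 * c * Re (x k * cnj (z k)) + c\<^sup>2 * (cmod (z k))\<^sup>2" for k
    unfolding cmod_power2 by (simp add: power2_eq_square algebra_simps)
  then show ?thesis
    unfolding nsq_def ip_def Re_sum
    by (simp only: sum.distrib sum_subtractf sum_distrib_left mult.assoc)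
qed

lemma cmod_ip_le: "(cmod (ip n x y))\<^sup>2 \<le> nsq n x * nsq n y"
proof -
  have "cmod (ip n x y) \<le> (\<Sum>k<n. cmod (x k) * cmod (y k))"
    unfolding ip_def by (rule order_trans[OF norm_sum]) (simp add: norm_mult)
  then have "(cmod (ip n x y))\<^sup>2 \<le> (\<Sum>k<n. cmod (x k) * cmod (y k))\<^sup>2"
    by (simp add: power_mono)
  also have "\<dots> \<le> nsq n x * nsq n y"
    unfolding nsq_def by (rule Cauchy_Schwarz_ineq_sum)
  finally show ?thesis .
qed

lemma cmod_le_sqrt_nsq: "k < n \<Longrightarrow> cmod (x k) \<le> sqrt (nsq n x)"
  unfolding nsq_def by (rule real_le_rsqrt, rule member_le_sum) auto

lemma sqrt_nsq_triangle:
  "sqrt (nsq n (\<lambda>k. x k + y k)) \<le> sqrt (nsq n x) + sqrt (nsq n y)"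
proof -
  have *: "sqrt (nsq n z) = L2_set (\<lambda>k. cmod (z k)) {..<n}" for z
    by (simp add: nsq_def L2_set_def)
  show ?thesis
    unfolding * by (rule order_trans[OF _ L2_set_triangle_ineq], rule L2_set_mono)
      (auto intro: norm_triangle_ineq)
qed

text \<open>Separates the diagonal from the two equal strict triangles; this is how the Gram form of
  a leaf splits into D, L and the adjoint of L.\<close>

lemma sum_square_symmetric:
  fixes H :: "nat \<Rightarrow> nat \<Rightarrow> real"
  assumes "\<And>r s. H r s = H s r"
  shows "(\<Sum>r<n. \<Sum>s<n. H r s) = (\<Sum>r<n. H r r) + 2 * (\<Sum>r<n. \<Sum>s<r. H r s)"
proof (induction n)
  case (Suc n)
  have "(\<Sum>r<n. H r n) = (\<Sum>s<n. H n s)"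
    using assms by simp
  with Suc show ?case by (simp add: sum.distrib)
qed simp

text \<open>Jensen's inequality for the squared modulus: each weight is split as
  \<open>sqrt (w i) * sqrt (w i)\<close> and Cauchy-Schwarz does the rest.\<close>

lemma cmod_weighted_mean_sq_le:
  fixes w :: "nat \<Rightarrow> real"
  assumes "\<And>i. i < t \<Longrightarrow> 0 < w i" and "(\<Sum>i<t. w i) = 1"
  shows "(cmod (\<Sum>i<t. of_real (w i) * z i))\<^sup>2 \<le> (\<Sum>i<t. w i * (cmod (z i))\<^sup>2)"
proof -
  have "cmod (\<Sum>i<t. of_real (w i) * z i) \<le> (\<Sum>i<t. w i * cmod (z i))"
    by (rule order_trans[OF norm_sum])
      (rule sum_mono, auto simp: norm_mult less_imp_le[OF assms(1)])
  also have "\<dots> = (\<Sum>i<t. sqrt (w i) * (sqrt (w i) * cmod (z i)))"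
    by (rule sum.cong) (auto simp: mult.assoc[symmetric] less_imp_le[OF assms(1)])
  finally have "(cmod (\<Sum>i<t. of_real (w i) * z i))\<^sup>2 \<le>
      (\<Sum>i<t. sqrt (w i) * (sqrt (w i) * cmod (z i)))\<^sup>2"
    by (simp add: power_mono)
  also have "\<dots> \<le> (\<Sum>i<t. (sqrt (w i))\<^sup>2) * (\<Sum>i<t. (sqrt (w i) * cmod (z i))\<^sup>2)"
    by (rule Cauchy_Schwarz_ineq_sum)
  also have "(\<Sum>i<t. (sqrt (w i))\<^sup>2) = 1"
    using assms by (simp add: less_imp_le)
  also have "(\<Sum>i<t. (sqrt (w i) * cmod (z i))\<^sup>2) = (\<Sum>i<t. w i * (cmod (z i))\<^sup>2)"
    by (rule sum.cong) (auto simp: power_mult_distrib less_imp_le[OF assms(1)])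
  finally show ?thesis by simp
qed

text \<open>Gram-Schmidt, by induction on the number of functions \<open>f j\<close>, for the inner
  product with weights \<mu>. Unit weights will split off the kernel of the rows; the weights
  \<open>wt r / diag r\<close> will solve the normal equations.\<close>

lemma orthogonal_residual_exists:
  fixes \<mu> :: "nat \<Rightarrow> real" and f :: "nat \<Rightarrow> nat \<Rightarrow> complex"
  assumes "\<And>i. i < n \<Longrightarrow> 0 < \<mu> i"
  shows "\<exists>c. \<forall>j<m. (\<Sum>i<n. of_real (\<mu> i) * (x i - (\<Sum>l<m. c l * f l i)) * cnj (f j i)) = 0"
proof (induction m arbitrary: x)
  case (Suc m)
  let ?P = "\<lambda>c x i. x i - (\<Sum>l<m. c l * f l i) :: complex"
  let ?b = "\<lambda>x y. \<Sum>i<n. of_real (\<mu> i) * x i * cnj (y i) :: complex"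
  have b_diff: "?b (\<lambda>i. x i - c * y i) z = ?b x z - c * ?b y z" for x y z c
    by (simp add: algebra_simps sum_subtractf sum_distrib_left)
  have b_add_right: "?b x (\<lambda>i. y i + z i) = ?b x y + ?b x z" for x y z
    by (simp add: algebra_simps sum.distrib)
  obtain c where c: "\<And>j. j < m \<Longrightarrow> ?b (?P c x) (f j) = 0"
    using Suc[of x] by blast
  \<comment> \<open>The induction hypothesis is used a second time, on \<open>f m\<close> itself;
    the residual \<open>q\<close> is the part of \<open>f m\<close> orthogonal to the earlier
    functions.\<close>
  obtain e where e: "\<And>j. j < m \<Longrightarrow> ?b (?P e (f m)) (f j) = 0"
    using Suc[of "f m"] by blast
  define q where "q = ?P e (f m)"
  have q_orth: "?b q (f j) = 0" if "j < m" for j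
    using e[OF that] by (simp add: q_def)
  have orth_comb: "?b y (\<lambda>i. \<Sum>l<m. e l * f l i) = 0" if "\<And>j. j < m \<Longrightarrow> ?b y (f j) = 0" for y
  proof -
    have "?b y (\<lambda>i. \<Sum>l<m. e l * f l i) = (\<Sum>i<n. \<Sum>l<m. cnj (e l) * (of_real (\<mu> i) * y i * cnj (f l i)))"
      by (simp add: sum_distrib_left algebra_simps)
    also have "\<dots> = (\<Sum>l<m. cnj (e l) * ?b y (f l))"
      by (subst sum.swap) (simp add: sum_distrib_left)
    also have "\<dots> = 0" using that by simp
    finally show ?thesis .
  qed
  have orth_fm: "?b y (f m) = ?b y q" if "\<And>j. j < m \<Longrightarrow> ?b y (f j) = 0" for y
  proof -
    have "?b y (f m) = ?b y (\<lambda>i. q i + (\<Sum>l<m. e l * f l i))"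
      by (simp add: q_def)
    then show ?thesis
      using orth_comb[OF that] b_add_right[of y q "\<lambda>i. \<Sum>l<m. e l * f l i"] by simp
  qed
  \<comment> \<open>The projection coefficient along \<open>q\<close>. If \<open>?b q q = 0\<close>,
    then positivity of the weights forces \<open>q\<close> to vanish below \<open>n\<close>, and
    orthogonality to \<open>q\<close> is trivial.\<close>
  define g where "g = ?b (?P c x) q / ?b q q"
  define y where "y = (\<lambda>i. ?P c x i - g * q i)"
  have y_orth: "?b y (f j) = 0" if "j < m" for j
    unfolding y_def b_diff using c[OF that] q_orth[OF that] by simp
  have "?b y q = 0"
  proof (cases "?b q q = 0")
    case True
    have "?b q q = of_real (\<Sum>i<n. \<mu> i * (cmod (q i))\<^sup>2)"
      by (simp add: complex_norm_square mult.assoc del: of_real_power)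
    with True have "(\<Sum>i<n. \<mu> i * (cmod (q i))\<^sup>2) = 0"
      by (simp del: of_real_sum)
    then have "\<forall>i\<in>{..<n}. \<mu> i * (cmod (q i))\<^sup>2 = 0"
      using assms by (subst (asm) sum_nonneg_eq_0_iff) (auto simp: less_imp_le)
    then have "q i = 0" if "i < n" for i
      using assms[OF that] that by force
    then show ?thesis by simp
  next
    case False
    then show ?thesis unfolding y_def b_diff by (simp add: g_def)
  qed
  then have y_orth': "?b y (f j) = 0" if "j < Suc m" for j
    using that y_orth orth_fm[of y] by (auto simp: less_Suc_eq)
  \<comment> \<open>Expanding \<open>q\<close> in the definition of \<open>y\<close> collects the
    coefficient of each \<open>f l\<close>.\<close>
  define h where "h = (\<lambda>l. if l = m then g else c l - g * e l)"
  have "y i = x i - (\<Sum>l<Suc m. h l * f l i)" for i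
    by (simp add: y_def q_def h_def algebra_simps sum_subtractf sum_distrib_left)
  with y_orth' show ?case
    by (intro exI[of _ h]) simp
qed simp

text \<open>In each coordinate the increments are dominated by a geometric series, so their
  telescoping sum converges.\<close>

lemma convergent_of_geometric_steps:
  fixes q :: real
  assumes "\<And>n. sqrt (nsq d (\<lambda>k. X (Suc n) k - X n k)) \<le> C * q ^ n" and "0 \<le> q" "q < 1"
    and "k < d"
  shows "convergent (\<lambda>n. X n k)"
proof -
  have "summable (\<lambda>n. X (Suc n) k - X n k)"
  proof (rule summable_comparison_test)
    show "\<exists>n0. \<forall>n\<ge>n0. norm (X (Suc n) k - X n k) \<le> C * q ^ n"
      using cmod_le_sqrt_nsq[OF assms(4)] assms(1) by (meson order_trans)
    show "summable (\<lambda>n. C * q ^ n)"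
      using assms by (intro summable_mult summable_geometric) auto
  qed
  then have "convergent (\<lambda>n. \<Sum>i<n. X (Suc i) k - X i k)"
    by (simp add: summable_iff_convergent)
  then have "convergent (\<lambda>n. X n k - X 0 k)"
    by (simp add: sum_lessThan_telescope[where f="\<lambda>i. X i k"])
  from convergent_add[OF this convergent_const[of "X 0 k"]] show ?thesis by simp
qed

subsection \<open>Weighted averages of relaxed sweeps\<close>

text \<open>Row \<open>r\<close> stands for one node occurrence on one root-to-leaf path,
  \<open>p r\<close> for that leaf, and \<open>w i\<close> for the weight of leaf \<open>i\<close>.
  A node shared by several paths contributes one row for each.\<close>

locale weighted_sweeps =
  fixes N d t :: nat and R :: "nat \<Rightarrow> nat \<Rightarrow> complex" and p :: "nat \<Rightarrow> nat" and w :: "nat \<Rightarrow> real"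
  assumes p_less: "\<And>r. r < N \<Longrightarrow> p r < t"
    and w_pos: "\<And>i. i < t \<Longrightarrow> 0 < w i"
    and w_sum: "(\<Sum>i<t. w i) = 1"
    and row_nonzero: "\<And>r. r < N \<Longrightarrow> \<exists>k<d. R r k \<noteq> 0"
begin

text \<open>\<open>app\<close> and \<open>adj\<close> play the roles of S and its adjoint, on
  functions of which only finitely many values matter.\<close>

definition app :: "(nat \<Rightarrow> complex) \<Rightarrow> nat \<Rightarrow> complex" where
  "app x r = (\<Sum>k<d. R r k * x k)"

definition adj :: "(nat \<Rightarrow> complex) \<Rightarrow> nat \<Rightarrow> complex" where
  "adj u k = (\<Sum>r<N. cnj (R r k) * u r)"

definition gram :: "nat \<Rightarrow> nat \<Rightarrow> complex" where
  "gram r s = (\<Sum>k<d. R r k * cnj (R s k))"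

definition diag :: "nat \<Rightarrow> real" where
  "diag r = nsq d (R r)"

text \<open>No order condition is built in: summed over \<open>s < r\<close> the entries form the
  strictly lower triangular blocks, summed over all \<open>s\<close> they give the full Gram block
  of a leaf.\<close>

definition low :: "nat \<Rightarrow> nat \<Rightarrow> complex" where
  "low r s = (if p r = p s then gram r s else 0)"

definition wt :: "nat \<Rightarrow> real" where
  "wt r = w (p r)"

text \<open>Forward substitution for the lower triangular system (D + \<omega> L) v = y. Only
  indices below \<open>N\<close> carry meaning.\<close>

fun sol :: "real \<Rightarrow> (nat \<Rightarrow> complex) \<Rightarrow> nat \<Rightarrow> complex" where
  "sol \<omega> y r = (y r - of_real \<omega> * (\<Sum>s<r. low r s * sol \<omega> y s)) / of_real (diag r)"

declare sol.simps [simp del]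

text \<open>The correction with the weights applied after the inverse of D + \<omega> L; the matrix
  definition applies them before, and \<open>M_inv_W\<close> reconciles the two orders.\<close>

definition corr :: "real \<Rightarrow> (nat \<Rightarrow> complex) \<Rightarrow> nat \<Rightarrow> complex" where
  "corr \<omega> y = adj (\<lambda>r. of_real (wt r) * sol \<omega> y r)"

definition in_range :: "(nat \<Rightarrow> complex) \<Rightarrow> bool" where
  "in_range x \<longleftrightarrow> (\<exists>y. \<forall>k<d. x k = adj y k)"

section \<open>Adjoint identities and forward substitution\<close>

lemma diag_pos: "r < N \<Longrightarrow> 0 < diag r"
  using row_nonzero[of r] unfolding diag_def nsq_def by (auto intro!: sum_pos2)

lemma wt_pos: "r < N \<Longrightarrow> 0 < wt r"
  by (simp add: wt_def w_pos p_less)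

lemma gram_diag: "gram r r = of_real (diag r)"
  using ip_self[of d "R r"] by (simp add: gram_def diag_def ip_def)

lemma gram_swap: "gram s r = cnj (gram r s)"
  by (simp add: gram_def mult.commute)

lemma ip_adj: "ip d x (adj u) = ip N (app x) u"
proof -
  have "ip d x (adj u) = (\<Sum>k<d. \<Sum>r<N. R r k * x k * cnj (u r))"
    by (simp add: ip_def adj_def sum_distrib_left algebra_simps)
  also have "\<dots> = (\<Sum>r<N. \<Sum>k<d. R r k * x k * cnj (u r))"
    by (rule sum.swap)
  finally show ?thesis by (simp add: ip_def app_def sum_distrib_right)
qed

lemma app_adj: "app (adj u) r = (\<Sum>s<N. gram r s * u s)"
proof -
  have "app (adj u) r = (\<Sum>k<d. \<Sum>s<N. R r k * cnj (R s k) * u s)"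
    by (simp add: app_def adj_def sum_distrib_left mult.assoc)
  also have "\<dots> = (\<Sum>s<N. \<Sum>k<d. R r k * cnj (R s k) * u s)"
    by (rule sum.swap)
  finally show ?thesis by (simp add: gram_def sum_distrib_right)
qed

lemma nsq_adj: "nsq d (adj u) = (\<Sum>r<N. \<Sum>s<N. Re (gram r s * u s * cnj (u r)))"
  unfolding nsq_eq_Re_ip ip_adj by (simp add: ip_def app_adj sum_distrib_right)

lemma app_diff: "app (\<lambda>k. x k - c * y k) r = app x r - c * app y r"
  by (simp add: app_def algebra_simps sum_subtractf sum_distrib_left)

lemma sol_eq:
  assumes "r < N"
  shows "of_real (diag r) * sol \<omega> y r + of_real \<omega> * (\<Sum>s<r. low r s * sol \<omega> y s) = y r"
  using diag_pos[OF assms] by (subst sol.simps) simp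

text \<open>Row \<open>r\<close> determines \<open>v r\<close> from the earlier entries. This later
  identifies \<open>sol\<close> with the action of an inverse matrix.\<close>

lemma sol_unique:
  assumes "\<And>r. r < N \<Longrightarrow> of_real (diag r) * v r + of_real \<omega> * (\<Sum>s<r. low r s * v s) = y r"
    and "r < N"
  shows "v r = sol \<omega> y r"
  using assms(2)
proof (induction r rule: less_induct)
  case (less r)
  then have "(\<Sum>s<r. low r s * v s) = (\<Sum>s<r. low r s * sol \<omega> y s)"
    by (intro sum.cong) auto
  then show ?case
    using assms(1)[of r] less.prems diag_pos[of r] by (subst sol.simps) (auto simp: field_simps)
qed

lemma sol_cong:
  assumes "\<And>r. r < N \<Longrightarrow> y r = z r" "r < N"
  shows "sol \<omega> y r = sol \<omega> z r"
  using sol_eq assms by (intro sol_unique) auto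

lemma sol_diff: "sol \<omega> (\<lambda>r. y r - z r) r = sol \<omega> y r - sol \<omega> z r"
proof (induction r rule: less_induct)
  case (less r)
  have "(\<Sum>s<r. low r s * sol \<omega> (\<lambda>r. y r - z r) s) =
      (\<Sum>s<r. low r s * sol \<omega> y s) - (\<Sum>s<r. low r s * sol \<omega> z s)"
    unfolding sum_subtractf[symmetric] using less by (intro sum.cong) (auto simp: right_diff_distrib)
  then show ?case
    by (subst (1 2 3) sol.simps) (simp add: diff_divide_distrib right_diff_distrib)
qed

lemma corr_diff: "corr \<omega> (\<lambda>r. y r - z r) k = corr \<omega> y k - corr \<omega> z k"
  by (simp add: corr_def adj_def sol_diff algebra_simps sum_subtractf)

lemma corr_cong:
  assumes "\<And>r. r < N \<Longrightarrow> y r = z r"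
  shows "corr \<omega> y = corr \<omega> z"
  using sol_cong[OF assms, where \<omega>=\<omega>] by (auto simp: corr_def adj_def)

section \<open>Energy decrease in one sweep\<close>

text \<open>The vector on the left is the weighted mean of the vectors coming from single leaves.
  Jensen bounds its square by the weighted mean of their squares, and each of these is a Gram form
  that splits into a diagonal and twice a lower triangle.\<close>

lemma nsq_adj_weighted_le:
  "nsq d (adj (\<lambda>r. of_real (wt r) * v r)) \<le>
     (\<Sum>r<N. wt r * diag r * (cmod (v r))\<^sup>2) +
     2 * Re (\<Sum>r<N. of_real (wt r) * (\<Sum>s<r. low r s * v s) * cnj (v r))"
proof -
  \<comment> \<open>\<open>\<zeta> i\<close> is the contribution of leaf \<open>i\<close> alone,
    without its weight; \<open>H\<close> is the weighted real Gram form, which vanishes between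
    different leaves.\<close>
  define \<zeta> where "\<zeta> i = adj (\<lambda>r. if p r = i then v r else 0)" for i
  define H where "H r s = wt r * Re (low r s * v s * cnj (v r))" for r s
  have "adj (\<lambda>r. of_real (wt r) * v r) k = (\<Sum>i<t. of_real (w i) * \<zeta> i k)" for k
  proof -
    have "(\<Sum>i<t. of_real (w i) * \<zeta> i k) =
        (\<Sum>r<N. \<Sum>i<t. if p r = i then of_real (w i) * (cnj (R r k) * v r) else 0)"
      unfolding \<zeta>_def adj_def sum_distrib_left
      by (subst sum.swap) (auto intro!: sum.cong)
    also have "\<dots> = (\<Sum>r<N. of_real (wt r) * (cnj (R r k) * v r))"
      by (rule sum.cong) (auto simp: sum.delta' wt_def p_less)
    finally show ?thesis by (simp add: adj_def algebra_simps)
  qed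
  then have "nsq d (adj (\<lambda>r. of_real (wt r) * v r)) \<le> (\<Sum>k<d. \<Sum>i<t. w i * (cmod (\<zeta> i k))\<^sup>2)"
    unfolding nsq_def using cmod_weighted_mean_sq_le[OF w_pos w_sum] by (intro sum_mono) simp
  also have "\<dots> = (\<Sum>i<t. w i * nsq d (\<zeta> i))"
    by (subst sum.swap) (simp add: nsq_def sum_distrib_left)
  also have "\<dots> = (\<Sum>i<t. \<Sum>r<N. \<Sum>s<N. if p r = i then H r s else 0)"
    unfolding \<zeta>_def nsq_adj sum_distrib_left H_def wt_def low_def
    by (intro sum.cong) auto
  also have "\<dots> = (\<Sum>r<N. \<Sum>s<N. \<Sum>i<t. if p r = i then H r s else 0)"
    by (subst sum.swap, rule sum.cong[OF refl], rule sum.swap)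
  also have "\<dots> = (\<Sum>r<N. \<Sum>s<N. H r s)"
    by (intro sum.cong) (auto simp: p_less)
  also have "\<dots> = (\<Sum>r<N. H r r) + 2 * (\<Sum>r<N. \<Sum>s<r. H r s)"
  proof (rule sum_square_symmetric)
    \<comment> \<open>The Gram matrix is Hermitian, and rows with nonzero \<open>low r s\<close>
      share a leaf and hence a weight.\<close>
    fix r s
    have "gram s r * v r * cnj (v s) = cnj (gram r s * v s * cnj (v r))"
      by (simp add: gram_swap[of s r])
    then have "Re (gram s r * v r * cnj (v s)) = Re (gram r s * v s * cnj (v r))"
      by (simp only: complex_cnj_cnj cnj.sel)
    then show "H r s = H s r" by (simp add: H_def low_def wt_def)
  qed
  also have "(\<Sum>r<N. H r r) = (\<Sum>r<N. wt r * diag r * (cmod (v r))\<^sup>2)"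
    unfolding H_def low_def cmod_power2
    by (rule sum.cong) (auto simp: gram_diag power2_eq_square algebra_simps)
  also have "(\<Sum>r<N. \<Sum>s<r. H r s) =
      Re (\<Sum>r<N. of_real (wt r) * (\<Sum>s<r. low r s * v s) * cnj (v r))"
    by (simp only: Re_sum sum_distrib_left sum_distrib_right H_def)
      (simp add: algebra_simps)
  finally show ?thesis .
qed

text \<open>The square is expanded with \<open>A\<close> the diagonal form and \<open>Y\<close> the
  lower triangular form of \<open>v\<close>. In \<open>- 2 * \<omega> * (A + \<omega> * Re Y) +
  \<omega>\<^sup>2 * (A + 2 * Re Y)\<close> the terms in \<open>Y\<close> cancel and
  \<open>- \<omega> * (2 - \<omega>) * A\<close> remains.\<close>

lemma nsq_sweep_le:
  assumes "0 < \<omega>"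
  shows "nsq d (\<lambda>k. x k - of_real \<omega> * corr \<omega> (app x) k) \<le>
     nsq d x - \<omega> * (2 - \<omega>) * (\<Sum>r<N. wt r * diag r * (cmod (sol \<omega> (app x) r))\<^sup>2)"
proof -
  define v where "v = sol \<omega> (app x)"
  define z where "z = corr \<omega> (app x)"
  define A where "A = (\<Sum>r<N. wt r * diag r * (cmod (v r))\<^sup>2)"
  define Y where "Y = (\<Sum>r<N. of_real (wt r) * (\<Sum>s<r. low r s * v s) * cnj (v r))"
  have z: "z = adj (\<lambda>r. of_real (wt r) * v r)"
    by (simp add: z_def corr_def v_def)
  have "ip d x z = (\<Sum>r<N. of_real (wt r) * app x r * cnj (v r))"
    unfolding z ip_adj by (simp add: ip_def algebra_simps)
  \<comment> \<open>Here \<open>app x\<close> is replaced through the triangular system that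
    \<open>v\<close> solves, which brings in the same form \<open>Y\<close> as in the bound on
    \<open>z\<close>.\<close>
  also have "\<dots> = (\<Sum>r<N. of_real (wt r) *
      (of_real (diag r) * v r + of_real \<omega> * (\<Sum>s<r. low r s * v s)) * cnj (v r))"
    unfolding v_def using sol_eq by (intro sum.cong) auto
  also have "\<dots> = of_real A + of_real \<omega> * Y"
    unfolding A_def Y_def
    by (simp add: algebra_simps sum.distrib sum_distrib_left complex_norm_square
        del: of_real_power)
  finally have "Re (ip d x z) = A + \<omega> * Re Y" by simp
  moreover have "nsq d z \<le> A + 2 * Re Y"
    unfolding z A_def Y_def by (rule nsq_adj_weighted_le)
  then have "\<omega>\<^sup>2 * nsq d z \<le> \<omega>\<^sup>2 * (A + 2 * Re Y)"
    by (simp add: mult_left_mono)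
  ultimately show ?thesis
    unfolding z_def[symmetric] v_def[symmetric] A_def[symmetric] nsq_diff_scaled
    by (simp add: algebra_simps power2_eq_square)
qed


section \<open>The range of the adjoint and uniform contraction on it\<close>

lemma in_range_adj: "in_range (adj y)"
  by (auto simp: in_range_def)

lemma in_range_add_scaled:
  assumes "in_range x" "in_range y"
  shows "in_range (\<lambda>k. x k + c * y k)"
proof -
  obtain u v where "\<forall>k<d. x k = adj u k" "\<forall>k<d. y k = adj v k"
    using assms by (auto simp: in_range_def)
  then have "\<forall>k<d. x k + c * y k = adj (\<lambda>r. u r + c * v r) k"
    by (simp add: adj_def algebra_simps sum.distrib sum_distrib_left)
  then show ?thesis by (auto simp: in_range_def)
qed

lemma in_range_diff: "in_range x \<Longrightarrow> in_range y \<Longrightarrow> in_range (\<lambda>k. x k - y k)"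
  using in_range_add_scaled[of x y "-1"] by simp

lemma in_range_corr: "in_range (corr \<omega> y)"
  by (simp add: corr_def in_range_adj)

lemma in_range_cong: "(\<And>k. k < d \<Longrightarrow> x k = y k) \<Longrightarrow> in_range y \<Longrightarrow> in_range x"
  by (auto simp: in_range_def)

text \<open>Projecting \<open>x\<close> onto the span of the conjugated rows leaves a residual
  orthogonal to them, and orthogonality to a conjugated row is annihilation by the corresponding
  component of \<open>app\<close>.\<close>

lemma range_kernel_decomposition:
  obtains c where "\<And>r. r < N \<Longrightarrow> app (\<lambda>k. x k - adj c k) r = 0"
proof -
  have "\<exists>c. \<forall>r<N. (\<Sum>k<d. of_real 1 * (x k - (\<Sum>l<N. c l * cnj (R l k))) * cnj (cnj (R r k))) = 0"
    using orthogonal_residual_exists[of d "\<lambda>_. 1" N x "\<lambda>r k. cnj (R r k)"] by simp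
  then obtain c where
    "\<And>r. r < N \<Longrightarrow> (\<Sum>k<d. (x k - (\<Sum>l<N. c l * cnj (R l k))) * R r k) = 0"
    by auto
  then have "app (\<lambda>k. x k - adj c k) r = 0" if "r < N" for r
    using that by (simp add: app_def adj_def mult.commute)
  then show ?thesis using that by blast
qed

text \<open>
  Writing each unit vector as an element of the range of the adjoint plus a kernel element
  expresses the coordinates of a range element \<open>x\<close> as fixed linear functions of \<open>app x\<close>.
\<close>

lemma nsq_le_app:
  obtains C where "0 < C" "\<And>x. in_range x \<Longrightarrow> nsq d x \<le> C * nsq N (app x)"
proof -
  define e where "e k i = (if i = k then 1 else 0 :: complex)" for k i :: nat
  have "\<forall>k. \<exists>c. \<forall>r<N. app (\<lambda>i. e k i - adj c i) r = 0"
    by (metis range_kernel_decomposition)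
  then obtain c where c: "\<And>k r. r < N \<Longrightarrow> app (\<lambda>i. e k i - adj (c k) i) r = 0"
    by metis
  define C where "C = (\<Sum>k<d. nsq N (c k)) + 1"
  have "nsq d x \<le> C * nsq N (app x)" if "in_range x" for x
  proof -
    obtain y where y: "\<And>k. k < d \<Longrightarrow> x k = adj y k"
      using \<open>in_range x\<close> by (auto simp: in_range_def)
    have "(cmod (x k))\<^sup>2 \<le> nsq N (c k) * nsq N (app x)" if "k < d" for k
    proof -
      \<comment> \<open>The kernel part \<open>q\<close> of the unit vector \<open>e k\<close> is
        orthogonal to the range, so only the range part \<open>adj (c k)\<close> contributes to
        \<open>x k\<close>.\<close>
      define q where "q = (\<lambda>i. e k i - adj (c k) i)"
      have "ip d q x = ip d q (adj y)"
        by (simp add: ip_def y)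
      also have "\<dots> = 0"
        unfolding ip_adj using c by (simp add: ip_def q_def)
      finally have "cnj (ip d q x) = 0" by simp
      then have "ip d x q = 0" by (simp add: ip_def mult.commute)
      moreover have "x k = ip d x (e k)"
        using that by (simp add: ip_def e_def if_distrib[of cnj] if_distrib[of "\<lambda>u. _ * u"] cong: if_cong)
      moreover have "ip d x (e k) = ip d x (adj (c k)) + ip d x q"
        by (simp add: ip_def q_def algebra_simps sum.distrib sum_subtractf)
      ultimately have "x k = ip N (app x) (c k)" by (simp add: ip_adj)
      then show ?thesis using cmod_ip_le[of N "app x" "c k"] by (simp add: mult.commute)
    qed
    then have "nsq d x \<le> (\<Sum>k<d. nsq N (c k) * nsq N (app x))"
      unfolding nsq_def[of d x] by (intro sum_mono) simp
    also have "\<dots> \<le> C * nsq N (app x)"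
      by (simp add: C_def sum_distrib_right[symmetric] distrib_right nsq_nonneg)
    finally show ?thesis .
  qed
  moreover have "0 < C"
    by (simp add: C_def add_nonneg_pos sum_nonneg nsq_nonneg)
  ultimately show ?thesis using that by blast
qed

text \<open>Since y = (D + \<omega> L) v with \<omega> below 2, \<open>y\<close> is bounded by
  \<open>v\<close> with a constant free of \<omega>; positive weights and diagonal entries bound
  \<open>v\<close> by the weighted form.\<close>

lemma nsq_le_sol:
  obtains C where "0 < C"
    "\<And>\<omega> y. 0 < \<omega> \<Longrightarrow> \<omega> < 2 \<Longrightarrow>
       nsq N y \<le> C * (\<Sum>r<N. wt r * diag r * (cmod (sol \<omega> y r))\<^sup>2)"
proof -
  \<comment> \<open>\<open>M r\<close> bounds the absolute row sum of D + \<omega> L with 2 in place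
    of \<omega>; \<open>K\<close> converts the weighted form into the plain squared norm. The
    \<open>+ 1\<close> in \<open>C\<close> keeps it positive even for \<open>N = 0\<close>.\<close>
  define M where "M r = diag r + 2 * (\<Sum>s<r. cmod (low r s))" for r
  define K where "K = (\<Sum>r<N. 1 / (wt r * diag r))"
  define C where "C = (\<Sum>r<N. (M r)\<^sup>2) * K + 1"
  have K: "0 \<le> K" unfolding K_def
    using wt_pos diag_pos by (intro sum_nonneg) (simp add: less_imp_le)
  have "nsq N y \<le> C * (\<Sum>r<N. wt r * diag r * (cmod (sol \<omega> y r))\<^sup>2)"
    if "0 < \<omega>" "\<omega> < 2" for \<omega> y
  proof -
    define v where "v = sol \<omega> y"
    define A where "A = (\<Sum>r<N. wt r * diag r * (cmod (v r))\<^sup>2)"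
    have term_nonneg: "0 \<le> wt r * diag r * (cmod (v r))\<^sup>2" if "r < N" for r
      using wt_pos[OF that] diag_pos[OF that] by simp
    then have A: "0 \<le> A" unfolding A_def by (intro sum_nonneg) auto
    have "(cmod (v r))\<^sup>2 \<le> 1 / (wt r * diag r) * A" if "r < N" for r
    proof -
      have "wt r * diag r * (cmod (v r))\<^sup>2 \<le> A"
        unfolding A_def using that term_nonneg by (intro member_le_sum) auto
      then show ?thesis
        using wt_pos[OF that] diag_pos[OF that] by (simp add: field_simps)
    qed
    then have v: "nsq N v \<le> K * A"
      unfolding nsq_def K_def sum_distrib_right by (intro sum_mono) auto
    have "(cmod (y r))\<^sup>2 \<le> (M r)\<^sup>2 * nsq N v" if "r < N" for r
    proof -
      have le: "cmod (v s) \<le> sqrt (nsq N v)" if "s \<le> r" for s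
        using \<open>r < N\<close> that by (intro cmod_le_sqrt_nsq) auto
      have "cmod (y r) = cmod (of_real (diag r) * v r + of_real \<omega> * (\<Sum>s<r. low r s * v s))"
        using sol_eq[OF that] by (simp add: v_def)
      also have "\<dots> \<le> diag r * cmod (v r) + \<omega> * (\<Sum>s<r. cmod (low r s) * cmod (v s))"
        using \<open>0 < \<omega>\<close> diag_pos[OF that]
        by (intro order_trans[OF norm_triangle_ineq] add_mono)
          (auto simp: norm_mult intro!: order_trans[OF norm_sum])
      also have "\<dots> \<le> diag r * sqrt (nsq N v) + 2 * (\<Sum>s<r. cmod (low r s) * sqrt (nsq N v))"
        using \<open>0 < \<omega>\<close> \<open>\<omega> < 2\<close> diag_pos[OF that]
        by (intro add_mono mult_mono sum_mono le mult_left_mono sum_nonneg) auto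
      also have "\<dots> = M r * sqrt (nsq N v)"
        by (simp add: M_def algebra_simps sum_distrib_left)
      finally have "(cmod (y r))\<^sup>2 \<le> (M r * sqrt (nsq N v))\<^sup>2"
        by (simp add: power_mono)
      then show ?thesis by (simp add: power_mult_distrib nsq_nonneg)
    qed
    then have "nsq N y \<le> (\<Sum>r<N. (M r)\<^sup>2) * nsq N v"
      unfolding nsq_def[of N y] sum_distrib_right by (intro sum_mono) auto
    also have "\<dots> \<le> (\<Sum>r<N. (M r)\<^sup>2) * (K * A)"
      by (intro mult_left_mono v sum_nonneg) auto
    also have "\<dots> \<le> C * A"
      using A by (simp add: C_def algebra_simps)
    finally show ?thesis unfolding A_def v_def .
  qed
  moreover have "0 < C"
    using K by (simp add: C_def add_nonneg_pos sum_nonneg)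
  ultimately show ?thesis using that by blast
qed

text \<open>Chains the two lower bounds: \<open>x\<close> is controlled by \<open>app x\<close>, and
  \<open>app x\<close> by the form lost in one sweep, both with constants independent of
  \<omega>.\<close>

lemma sweep_contraction:
  obtains c where "0 < c"
    "\<And>\<omega>. 0 < \<omega> \<Longrightarrow> \<omega> < 2 \<Longrightarrow> \<omega> * (2 - \<omega>) * c < 1"
    "\<And>\<omega> x. 0 < \<omega> \<Longrightarrow> \<omega> < 2 \<Longrightarrow> in_range x \<Longrightarrow>
       sqrt (nsq d (\<lambda>k. x k - of_real \<omega> * corr \<omega> (app x) k)) \<le>
         (1 - \<omega> * (2 - \<omega>) * c) * sqrt (nsq d x)"
proof -
  obtain C1 where C1: "0 < C1" "\<And>x. in_range x \<Longrightarrow> nsq d x \<le> C1 * nsq N (app x)"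
    using nsq_le_app by blast
  obtain C2 where C2: "0 < C2" "\<And>\<omega> y. 0 < \<omega> \<Longrightarrow> \<omega> < 2 \<Longrightarrow>
       nsq N y \<le> C2 * (\<Sum>r<N. wt r * diag r * (cmod (sol \<omega> y r))\<^sup>2)"
    using nsq_le_sol by blast
  \<comment> \<open>The factor 2 is spent on the square root, through
    \<open>1 - 2 * \<tau> \<le> (1 - \<tau>)\<^sup>2\<close>. The \<open>+ 1\<close> gives
    \<open>c \<le> 1 / 2\<close>, which keeps the contraction factor positive.\<close>
  define c where "c = 1 / (2 * (C1 * C2 + 1))"
  have CC: "0 < C1 * C2" using C1 C2 by simp
  have c: "0 < c" "c \<le> 1 / 2"
    using CC by (auto simp: c_def field_simps)
  have \<omega>2: "\<omega> * (2 - \<omega>) \<le> 1" for \<omega> :: real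
    using zero_le_power2[of "\<omega> - 1"] by (simp add: power2_eq_square algebra_simps)
  have small: "\<omega> * (2 - \<omega>) * c \<le> 1 / 2" if "0 < \<omega>" "\<omega> < 2" for \<omega> :: real
    using mult_mono[OF \<omega>2[of \<omega>] c(2)] c by simp
  have "sqrt (nsq d (\<lambda>k. x k - of_real \<omega> * corr \<omega> (app x) k)) \<le>
         (1 - \<omega> * (2 - \<omega>) * c) * sqrt (nsq d x)"
    if \<omega>: "0 < \<omega>" "\<omega> < 2" and x: "in_range x" for \<omega> x
  proof -
    define A where "A = (\<Sum>r<N. wt r * diag r * (cmod (sol \<omega> (app x) r))\<^sup>2)"
    define \<tau> where "\<tau> = \<omega> * (2 - \<omega>) * c"
    have "nsq d x \<le> C1 * (C2 * A)"
      using C1(2)[OF x] C2(2)[OF \<omega>, of "app x"] C1(1)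
      by (metis A_def mult_le_cancel_left_pos order_trans)
    also have "\<dots> \<le> (C1 * C2 + 1) * A"
    proof -
      have "0 \<le> A" unfolding A_def
        using wt_pos diag_pos by (intro sum_nonneg) (simp add: less_imp_le)
      then show ?thesis by (simp add: algebra_simps)
    qed
    finally have "2 * c * nsq d x \<le> 2 * c * ((C1 * C2 + 1) * A)"
      using c(1) by (intro mult_left_mono) auto
    also have "\<dots> = A"
    proof -
      have "2 * c * (C1 * C2 + 1) = 1"
        using CC unfolding c_def by (subst times_divide_eq_right) (simp add: divide_eq_eq)
      then show ?thesis by (simp only: mult.assoc[symmetric] mult_1)
    qed
    finally have "2 * c * nsq d x \<le> A" .
    then have "\<omega> * (2 - \<omega>) * (2 * c * nsq d x) \<le> \<omega> * (2 - \<omega>) * A"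
      using \<omega> by (intro mult_left_mono) auto
    then have "nsq d (\<lambda>k. x k - of_real \<omega> * corr \<omega> (app x) k) \<le> (1 - 2 * \<tau>) * nsq d x"
      using nsq_sweep_le[OF \<omega>(1), of x] by (simp add: A_def \<tau>_def algebra_simps)
    also have "\<dots> \<le> (1 - \<tau>)\<^sup>2 * nsq d x"
      by (intro mult_right_mono nsq_nonneg) (simp add: power2_eq_square algebra_simps)
    finally have "sqrt (nsq d (\<lambda>k. x k - of_real \<omega> * corr \<omega> (app x) k)) \<le> \<bar>1 - \<tau>\<bar> * sqrt (nsq d x)"
      using real_sqrt_le_mono by (fastforce simp: real_sqrt_mult)
    then show ?thesis using small[OF \<omega>] by (simp add: \<tau>_def)
  qed
  with c small show ?thesis by (intro that[of c]) (auto intro: order_le_less_trans[OF small])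
qed

section \<open>Relaxation sequences\<close>

text \<open>A predicate instead of a recursive function: the step is imposed below \<open>d\<close>
  only, so coordinates of vectors, which are unspecified from \<open>d\<close> on, also
  qualify.\<close>

definition relaxation :: "real \<Rightarrow> (nat \<Rightarrow> complex) \<Rightarrow> (nat \<Rightarrow> nat \<Rightarrow> complex) \<Rightarrow> bool" where
  "relaxation \<omega> \<beta> X \<longleftrightarrow> in_range (X 0) \<and>
     (\<forall>n. \<forall>k<d. X (Suc n) k = X n k + of_real \<omega> * corr \<omega> (\<lambda>r. \<beta> r - app (X n) r) k)"

lemma relaxation_in_range:
  assumes "relaxation \<omega> \<beta> X"
  shows "in_range (X n)"
proof (induction n)
  case (Suc n)
  show ?case
    by (rule in_range_cong[OF _ in_range_add_scaled[OF Suc in_range_corr]])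
      (use assms in \<open>auto simp: relaxation_def\<close>)
qed (use assms in \<open>simp add: relaxation_def\<close>)

text \<open>A sequence and its shift follow the same iteration, so a bound on differences of two
  sequences becomes a bound on consecutive steps.\<close>

lemma relaxation_shift: "relaxation \<omega> \<beta> X \<Longrightarrow> relaxation \<omega> \<beta> (\<lambda>n. X (Suc n))"
  using relaxation_in_range[of \<omega> \<beta> X 1] by (simp add: relaxation_def)

text \<open>The data \<beta> cancel by linearity of \<open>corr\<close>, leaving the homogeneous
  sweep to which the contraction applies.\<close>

lemma relaxation_diff:
  assumes "relaxation \<omega> \<beta> X" "relaxation \<omega> \<beta> Y" "k < d"
  shows "X (Suc n) k - Y (Suc n) k =
    (X n k - Y n k) - of_real \<omega> * corr \<omega> (app (\<lambda>k. X n k - Y n k)) k"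
proof -
  have "app (\<lambda>k. X n k - Y n k) = (\<lambda>r. (\<beta> r - app (Y n) r) - (\<beta> r - app (X n) r))"
    using app_diff[of "X n" 1 "Y n"] by auto
  then have "corr \<omega> (app (\<lambda>k. X n k - Y n k)) k =
      corr \<omega> (\<lambda>r. \<beta> r - app (Y n) r) k - corr \<omega> (\<lambda>r. \<beta> r - app (X n) r) k"
    by (simp only: corr_diff)
  then show ?thesis
    using assms by (simp only: relaxation_def) (simp add: right_diff_distrib)
qed

section \<open>Weighted least squares\<close>

text \<open>The weighted projection of \<beta> onto the span of the columns of \<open>R\<close>
  solves the normal equations; dropping the kernel part of the coefficient vector moves it into the
  range without changing \<open>app\<close>.\<close>

lemma normal_equations_solution:
  obtains x where "in_range x"
    "\<And>k. k < d \<Longrightarrow> adj (\<lambda>r. of_real (wt r) * ((\<beta> r - app x r) / of_real (diag r))) k = 0"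
proof -
  have "\<exists>z. \<forall>k<d. (\<Sum>r<N. of_real (wt r / diag r) * (\<beta> r - (\<Sum>l<d. z l * R r l)) * cnj (R r k)) = 0"
    using wt_pos diag_pos by (intro orthogonal_residual_exists[where f="\<lambda>k r. R r k"]) simp
  then obtain z where z: "\<And>k. k < d \<Longrightarrow>
      (\<Sum>r<N. of_real (wt r / diag r) * (\<beta> r - app z r) * cnj (R r k)) = 0"
    by (auto simp: app_def mult.commute)
  obtain c where c: "\<And>r. r < N \<Longrightarrow> app (\<lambda>k. z k - adj c k) r = 0"
    using range_kernel_decomposition[of z] by blast
  have "app z r = app (adj c) r" if "r < N" for r
    using c[OF that] app_diff[of z 1 "adj c" r] by simp
  then have "adj (\<lambda>r. of_real (wt r) * ((\<beta> r - app (adj c) r) / of_real (diag r))) k =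
      (\<Sum>r<N. of_real (wt r / diag r) * (\<beta> r - app z r) * cnj (R r k))" for k
    unfolding adj_def by (intro sum.cong) auto
  with z that[of "adj c"] show ?thesis by (simp add: in_range_adj)
qed

text \<open>Pythagoras: passing from \<open>x\<close> to \<open>z\<close> changes the residual by
  \<open>app h\<close>, which the normal equations make orthogonal to the residual at
  \<open>x\<close>; the square of \<open>app h\<close> is then dropped.\<close>

lemma normal_equations_minimize:
  assumes "\<And>k. k < d \<Longrightarrow> adj (\<lambda>r. of_real (wt r) * ((\<beta> r - app x r) / of_real (diag r))) k = 0"
  shows "(\<Sum>r<N. wt r / diag r * (cmod (\<beta> r - app x r))\<^sup>2) \<le>
    (\<Sum>r<N. wt r / diag r * (cmod (\<beta> r - app z r))\<^sup>2)"
proof -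
  define e where "e r = \<beta> r - app x r" for r
  define h where "h = (\<lambda>k. z k - x k)"
  define u where "u r = of_real (wt r) * (e r / of_real (diag r))" for r
  have \<beta>z: "\<beta> r - app z r = e r - app h r" for r
    using app_diff[of z 1 x r] by (simp add: e_def h_def)
  have "ip N (app h) u = ip d h (adj u)" by (simp add: ip_adj)
  also have "\<dots> = 0" using assms by (simp add: ip_def u_def[abs_def] e_def del: times_divide_eq_right)
  finally have "Re (ip N (app h) u) = 0" by simp
  then have orth: "(\<Sum>r<N. wt r / diag r * Re (app h r * cnj (e r))) = 0"
    by (simp add: ip_def u_def algebra_simps add_divide_distrib sum.distrib)
  have "wt r / diag r * ((cmod (e r))\<^sup>2 - 2 * Re (app h r * cnj (e r)))
      \<le> wt r / diag r * (cmod (\<beta> r - app z r))\<^sup>2" if "r < N" for r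
  proof (rule mult_left_mono)
    have "(cmod (e r - app h r))\<^sup>2 =
        (cmod (e r))\<^sup>2 - 2 * Re (app h r * cnj (e r)) + (cmod (app h r))\<^sup>2"
      unfolding cmod_power2 by (simp add: power2_eq_square algebra_simps)
    then show "(cmod (e r))\<^sup>2 - 2 * Re (app h r * cnj (e r)) \<le> (cmod (\<beta> r - app z r))\<^sup>2"
      by (simp add: \<beta>z)
  qed (use wt_pos[OF that] diag_pos[OF that] in simp)
  then have "(\<Sum>r<N. wt r / diag r * ((cmod (e r))\<^sup>2 - 2 * Re (app h r * cnj (e r))))
      \<le> (\<Sum>r<N. wt r / diag r * (cmod (\<beta> r - app z r))\<^sup>2)"
    by (intro sum_mono) auto
  moreover have "(\<Sum>r<N. wt r / diag r * ((cmod (e r))\<^sup>2 - 2 * Re (app h r * cnj (e r)))) =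
      (\<Sum>r<N. wt r / diag r * (cmod (e r))\<^sup>2) -
      2 * (\<Sum>r<N. wt r / diag r * Re (app h r * cnj (e r)))"
    by (simp only: right_diff_distrib sum_subtractf sum_distrib_left mult.left_commute)
  ultimately show ?thesis using orth unfolding e_def by linarith
qed

section \<open>Vanishing relaxation parameter\<close>

text \<open>The system degenerates to D v = y: by induction the earlier entries converge, and the
  sum over them carries the factor \<omega>.\<close>

lemma sol_tendsto:
  "((\<lambda>\<omega>. sol \<omega> y r) \<longlongrightarrow> y r / of_real (diag r)) (at 0 within S)"
proof (induction r rule: less_induct)
  case (less r)
  have "((\<lambda>\<omega>. (y r - of_real \<omega> * (\<Sum>s<r. low r s * sol \<omega> y s)) / of_real (diag r)) \<longlongrightarrow>
      (y r - of_real 0 * (\<Sum>s<r. low r s * (y s / of_real (diag s)))) / of_real (diag r)) (at 0 within S)"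
    unfolding divide_inverse by (intro tendsto_intros less[unfolded divide_inverse]) auto
  then show ?case by (subst sol.simps) simp
qed

lemma corr_tendsto:
  "((\<lambda>\<omega>. corr \<omega> y k) \<longlongrightarrow> adj (\<lambda>r. of_real (wt r) * (y r / of_real (diag r))) k) (at 0 within S)"
  unfolding corr_def adj_def by (intro tendsto_intros sol_tendsto)

theorem relaxation_limits:
  obtains x xs where
    "\<And>\<omega> X k. \<omega> \<in> {0<..<2} \<Longrightarrow> relaxation \<omega> \<beta> X \<Longrightarrow> k < d \<Longrightarrow> (\<lambda>n. X n k) \<longlonglongrightarrow> x \<omega> k"
    "\<And>k. k < d \<Longrightarrow> ((\<lambda>\<omega>. x \<omega> k) \<longlongrightarrow> xs k) (at 0 within {0<..<2})"
    "\<And>z. (\<Sum>r<N. wt r / diag r * (cmod (\<beta> r - app xs r))\<^sup>2) \<le>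
       (\<Sum>r<N. wt r / diag r * (cmod (\<beta> r - app z r))\<^sup>2)"
proof -
  obtain xs where xs: "in_range xs" and
    normal: "\<And>k. k < d \<Longrightarrow> adj (\<lambda>r. of_real (wt r) * ((\<beta> r - app xs r) / of_real (diag r))) k = 0"
    using normal_equations_solution[of \<beta>] by blast
  obtain c where c: "0 < c" "\<And>\<omega>. 0 < \<omega> \<Longrightarrow> \<omega> < 2 \<Longrightarrow> \<omega> * (2 - \<omega>) * c < 1"
    "\<And>\<omega> x. 0 < \<omega> \<Longrightarrow> \<omega> < 2 \<Longrightarrow> in_range x \<Longrightarrow>
       sqrt (nsq d (\<lambda>k. x k - of_real \<omega> * corr \<omega> (app x) k)) \<le>
         (1 - \<omega> * (2 - \<omega>) * c) * sqrt (nsq d x)"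
    using sweep_contraction by blast
  define q where "q \<omega> = 1 - \<omega> * (2 - \<omega>) * c" for \<omega>
  have q: "0 \<le> q \<omega>" "q \<omega> < 1" if "\<omega> \<in> {0<..<2}" for \<omega>
    using c(1) c(2)[of \<omega>] that by (auto simp: q_def)
  have diff_le: "sqrt (nsq d (\<lambda>k. X n k - Y n k)) \<le> sqrt (nsq d (\<lambda>k. X 0 k - Y 0 k)) * q \<omega> ^ n"
    if \<omega>: "\<omega> \<in> {0<..<2}" and XY: "relaxation \<omega> \<beta> X" "relaxation \<omega> \<beta> Y" for \<omega> X Y n
  proof (induction n)
    case (Suc n)
    define D where "D = (\<lambda>k. X n k - Y n k)"
    have "nsq d (\<lambda>k. X (Suc n) k - Y (Suc n) k) = nsq d (\<lambda>k. D k - of_real \<omega> * corr \<omega> (app D) k)"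
      unfolding D_def by (rule nsq_cong) (rule relaxation_diff[OF XY])
    also have "sqrt \<dots> \<le> q \<omega> * sqrt (nsq d D)"
      unfolding q_def D_def using \<omega> XY
      by (intro c(3) in_range_diff relaxation_in_range) auto
    also have "\<dots> \<le> q \<omega> * (sqrt (nsq d (\<lambda>k. X 0 k - Y 0 k)) * q \<omega> ^ n)"
      using Suc q[OF \<omega>] unfolding D_def by (intro mult_left_mono)
    finally show ?case by (simp add: algebra_simps)
  qed simp
  \<comment> \<open>The sequence is compared with its own shift, so its steps decay
    geometrically.\<close>
  have conv: "convergent (\<lambda>n. X n k)"
    if "\<omega> \<in> {0<..<2}" "relaxation \<omega> \<beta> X" "k < d" for \<omega> X k
    using convergent_of_geometric_steps[OF diff_le[OF that(1) relaxation_shift[OF that(2)] that(2)]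
        q[OF that(1)] that(3)] .
  have same: "(\<lambda>n. X n k - Y n k) \<longlonglongrightarrow> 0"
    if "\<omega> \<in> {0<..<2}" "relaxation \<omega> \<beta> X" "relaxation \<omega> \<beta> Y" "k < d" for \<omega> X Y k
  proof (rule tendsto_0_le[where K=1])
    show "\<forall>\<^sub>F n in sequentially. norm (X n k - Y n k) \<le>
        norm (sqrt (nsq d (\<lambda>k. X 0 k - Y 0 k)) * q \<omega> ^ n) * 1"
      using order_trans[OF cmod_le_sqrt_nsq[OF that(4), of "\<lambda>k. X _ k - Y _ k"] diff_le[OF that(1-3)]]
      by (intro always_eventually allI) (auto intro: order_trans[OF _ abs_ge_self])
    show "(\<lambda>n. sqrt (nsq d (\<lambda>k. X 0 k - Y 0 k)) * q \<omega> ^ n) \<longlonglongrightarrow> 0"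
      using q[OF that(1)] by (intro tendsto_mult_right_zero LIMSEQ_realpow_zero) auto
  qed
  \<comment> \<open>The reference sequence starts at the least squares point \<open>xs\<close>. Its
    limit serves as \<open>x \<omega>\<close>, and \<open>same\<close> gives every other sequence
    the same limit.\<close>
  define Z where "Z \<omega> n = ((\<lambda>x k. x k + of_real \<omega> * corr \<omega> (\<lambda>r. \<beta> r - app x r) k) ^^ n) xs" for \<omega> n
  have Z0: "Z \<omega> 0 = xs" for \<omega> by (simp add: Z_def)
  have ZSuc: "Z \<omega> (Suc n) k = Z \<omega> n k + of_real \<omega> * corr \<omega> (\<lambda>r. \<beta> r - app (Z \<omega> n) r) k" for \<omega> n k
    by (simp add: Z_def)
  have Z: "relaxation \<omega> \<beta> (Z \<omega>)" for \<omega>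
    using xs by (simp add: relaxation_def Z0 ZSuc)
  define x where "x \<omega> k = lim (\<lambda>n. Z \<omega> n k)" for \<omega> k
  have Z_lim: "(\<lambda>n. Z \<omega> n k) \<longlonglongrightarrow> x \<omega> k" if "\<omega> \<in> {0<..<2}" "k < d" for \<omega> k
    using conv[OF that(1) Z that(2)] by (simp add: x_def convergent_LIMSEQ_iff)
  define g where "g \<omega> = corr \<omega> (\<lambda>r. \<beta> r - app xs r)" for \<omega>
  \<comment> \<open>The fixed point of the recursive bound \<open>e \<le> q \<omega> * e + \<omega>
    * sqrt (nsq d (g \<omega>))\<close>. Since
    \<open>1 - q \<omega> = \<omega> * (2 - \<omega>) * c\<close>, the factor \<omega> cancels and
    the denominator stays away from 0 near \<open>\<omega> = 0\<close>.\<close>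
  define B where "B \<omega> = sqrt (nsq d (g \<omega>)) / ((2 - \<omega>) * c)" for \<omega>
  have Z_le: "sqrt (nsq d (\<lambda>k. Z \<omega> n k - xs k)) \<le> B \<omega>" if \<omega>: "\<omega> \<in> {0<..<2}" for \<omega> n
  proof (induction n)
    case 0
    then show ?case using \<omega> c(1) by (simp add: Z0 B_def nsq_def sum_nonneg)
  next
    case (Suc n)
    define D where "D = (\<lambda>k. Z \<omega> n k - xs k)"
    have "Z \<omega> (Suc n) k - xs k = (D k - of_real \<omega> * corr \<omega> (app D) k) + of_real \<omega> * g \<omega> k" for k
    proof -
      have "(\<lambda>r. \<beta> r - app (Z \<omega> n) r) = (\<lambda>r. (\<beta> r - app xs r) - app D r)"
        using app_diff[of "Z \<omega> n" 1 xs] by (auto simp: D_def)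
      then have "corr \<omega> (\<lambda>r. \<beta> r - app (Z \<omega> n) r) k = g \<omega> k - corr \<omega> (app D) k"
        by (simp only: corr_diff g_def)
      then show ?thesis by (simp add: ZSuc D_def right_diff_distrib)
    qed
    then have "sqrt (nsq d (\<lambda>k. Z \<omega> (Suc n) k - xs k)) \<le>
        sqrt (nsq d (\<lambda>k. D k - of_real \<omega> * corr \<omega> (app D) k)) + sqrt (nsq d (\<lambda>k. of_real \<omega> * g \<omega> k))"
      by (simp only: sqrt_nsq_triangle)
    also have "sqrt (nsq d (\<lambda>k. of_real \<omega> * g \<omega> k)) = \<omega> * sqrt (nsq d (g \<omega>))"
      using \<omega> by (simp add: nsq_def norm_mult power_mult_distrib real_sqrt_mult flip: sum_distrib_left)
    also have "\<dots> = (1 - q \<omega>) * B \<omega>"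
      using \<omega> c(1) by (simp add: q_def B_def)
    also have "sqrt (nsq d (\<lambda>k. D k - of_real \<omega> * corr \<omega> (app D) k)) \<le> q \<omega> * sqrt (nsq d D)"
      unfolding q_def D_def using \<omega> xs relaxation_in_range[OF Z]
      by (intro c(3) in_range_diff) auto
    also have "\<dots> \<le> q \<omega> * B \<omega>"
      using Suc q[OF \<omega>] unfolding D_def by (intro mult_left_mono)
    finally show ?case by (simp add: algebra_simps)
  qed
  have x_le: "cmod (x \<omega> k - xs k) \<le> B \<omega>" if "\<omega> \<in> {0<..<2}" "k < d" for \<omega> k
  proof (rule LIMSEQ_le_const2)
    show "(\<lambda>n. cmod (Z \<omega> n k - xs k)) \<longlonglongrightarrow> cmod (x \<omega> k - xs k)"
      by (intro tendsto_intros Z_lim that)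
    show "\<exists>n0. \<forall>n\<ge>n0. cmod (Z \<omega> n k - xs k) \<le> B \<omega>"
      using order_trans[OF cmod_le_sqrt_nsq[OF that(2), of "\<lambda>k. Z \<omega> _ k - xs k"] Z_le[OF that(1)]]
      by blast
  qed
  have g_lim: "((\<lambda>\<omega>. g \<omega> k) \<longlongrightarrow> 0) (at 0 within {0<..<2})" if "k < d" for k
    using corr_tendsto[of "\<lambda>r. \<beta> r - app xs r" k] normal[OF that] by (simp add: g_def)
  have "((\<lambda>\<omega>. nsq d (g \<omega>)) \<longlongrightarrow> (\<Sum>k<d. (cmod 0)\<^sup>2)) (at 0 within {0<..<2})"
    unfolding nsq_def by (intro tendsto_intros g_lim) auto
  then have "(B \<longlongrightarrow> sqrt (\<Sum>k<d. (cmod 0)\<^sup>2) / ((2 - 0) * c)) (at 0 within {0<..<2})"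
    unfolding B_def using c(1) by (intro tendsto_intros) auto
  then have B: "(B \<longlongrightarrow> 0) (at 0 within {0<..<2})" by simp
  show ?thesis
  proof (rule that[of x xs])
    fix \<omega> X k assume *: "\<omega> \<in> {0<..<2::real}" "relaxation \<omega> \<beta> X" "k < d"
    show "(\<lambda>n. X n k) \<longlonglongrightarrow> x \<omega> k"
      using tendsto_add[OF same[OF *(1,2) Z *(3)] Z_lim[OF *(1,3)]] by simp
  next
    fix k assume "k < d"
    have "((\<lambda>\<omega>. x \<omega> k - xs k) \<longlongrightarrow> 0) (at 0 within {0<..<2})"
      by (rule tendsto_0_le[OF B, where K=1], unfold eventually_at_filter, rule always_eventually)
        (auto intro: order_trans[OF x_le[OF _ \<open>k < d\<close>] abs_ge_self])
    then show "((\<lambda>\<omega>. x \<omega> k) \<longlongrightarrow> xs k) (at 0 within {0<..<2})"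
      by (simp add: LIM_zero_iff)
  qed (rule normal_equations_minimize[OF normal])
qed

end

subsection \<open>The matrices of a weighted tree\<close>


text \<open>The node occurrences in the order of the rows of S. Leaves are told apart by number, so
  repeated names or equal paths stay distinct.\<close>

fun labelled_nodes :: "nat \<Rightarrow> (real list \<times> 'v list) list \<Rightarrow> (nat \<times> real \<times> 'v) list" where
  "labelled_nodes n [] = []"
| "labelled_nodes n ((ws, vs) # ps) =
     map (\<lambda>v. (n, prod_list ws, v)) vs @ labelled_nodes (Suc n) ps"

lemma labelled_nodesD:
  "(i, c, v) \<in> set (labelled_nodes n ps) \<Longrightarrow>
    n \<le> i \<and> i < n + length ps \<and> c = prod_list (fst (ps ! (i - n))) \<and> v \<in> set (snd (ps ! (i - n)))"
proof (induction n ps rule: labelled_nodes.induct)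
  case (2 n ws vs ps)
  then show ?case
    by (auto simp: nth_Cons' Suc_diff_le Suc_le_eq diff_Suc split: nat.splits)
qed simp

lemma concat_map_nodes:
  "concat (map (\<lambda>(ws, vs). map f vs) ps) = map (\<lambda>(i, c, v). f v) (labelled_nodes n ps)"
  by (induction n ps rule: labelled_nodes.induct) auto

text \<open>Turns nested blocks into a single entry formula with global indices. The assumption
  \<open>shift\<close> says that \<open>h\<close> sees only the relative position of its indices, as
  the tests \<open>i = j\<close> and \<open>j < i\<close> do, so local and global indices give the
  same entry.\<close>

lemma diag_block_mat_labelled:
  fixes h :: "real \<times> 'v \<Rightarrow> real \<times> 'v \<Rightarrow> nat \<Rightarrow> nat \<Rightarrow> complex"
  assumes shift: "\<And>x y i j m. h x y (i + m) (j + m) = h x y i j"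
  shows "diag_block_mat (map (\<lambda>(ws, vs). mat (length vs) (length vs)
      (\<lambda>(i, j). h (prod_list ws, vs ! i) (prod_list ws, vs ! j) i j)) ps) =
    mat (length (labelled_nodes n ps)) (length (labelled_nodes n ps))
      (\<lambda>(i, j). if fst (labelled_nodes n ps ! i) = fst (labelled_nodes n ps ! j)
         then h (snd (labelled_nodes n ps ! i)) (snd (labelled_nodes n ps ! j)) i j else 0)"
proof (induction n ps rule: labelled_nodes.induct)
  case (2 n ws vs ps)
  let ?X = "labelled_nodes (Suc n) ps"
  \<comment> \<open>Labels in the tail start at \<open>Suc n\<close>, so they never equal the label
    \<open>n\<close> of the first block and the off-diagonal blocks vanish.\<close>
  have label: "fst (?X ! (i - length vs)) \<noteq> n"
    if "length vs \<le> i" "i < length vs + length ?X" for i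
    using labelled_nodesD[of "fst (?X ! (i - length vs))" "fst (snd (?X ! (i - length vs)))"
        "snd (snd (?X ! (i - length vs)))" "Suc n" ps]
      nth_mem[of "i - length vs" ?X] that by simp
  have shift': "h x y (i - m) (j - m) = h x y i j" if "m \<le> i" "m \<le> j" for x y i j m
    using shift[of x y "i - m" m "j - m"] that by simp
  show ?case
    unfolding labelled_nodes.simps list.map(2) diag_block_mat.simps Let_def prod.case 2
    by (rule eq_matI)
      (auto simp: nth_append shift' label label[symmetric])
qed auto

text \<open>By induction the leaf weights of each subtree sum to 1; prefixing an edge scales that
  sum by the edge weight, and the edge weights below a node sum to 1.\<close>

lemma leaf_paths_weights:
  assumes "normalized_weights T"
  shows "(\<Sum>p\<leftarrow>leaf_paths T. prod_list (fst p)) = 1"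
    and "p \<in> set (leaf_paths T) \<Longrightarrow> 0 < prod_list (fst p)"
    and "p \<in> set (leaf_paths T) \<Longrightarrow> set (snd p) \<subseteq> set_wtree T"
proof -
  have "(\<Sum>p\<leftarrow>leaf_paths T. prod_list (fst p)) = 1 \<and>
    (\<forall>p\<in>set (leaf_paths T). 0 < prod_list (fst p) \<and> set (snd p) \<subseteq> set_wtree T)"
    using assms
  proof (induction T rule: leaf_paths.induct)
    case (1 v ts)
    show ?case
    proof (cases "ts = []")
      case False
      have IH: "(\<Sum>p\<leftarrow>leaf_paths t. prod_list (fst p)) = 1"
        "\<forall>p\<in>set (leaf_paths t). 0 < prod_list (fst p) \<and> set (snd p) \<subseteq> set_wtree t" "0 < c"
        if "(c, t) \<in> set ts" for c t
        using 1(1)[OF False that refl] 1(2) that by auto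
      \<comment> \<open>Stated for every list of children drawn from \<open>ts\<close>, because the
        induction passes through partial sums that need not be 1.\<close>
      have "(\<Sum>p\<leftarrow>concat (map (\<lambda>(c, t). map (\<lambda>(ws, vs). (c # ws, v # vs)) (leaf_paths t)) us).
          prod_list (fst p)) = sum_list (map fst us)" if "set us \<subseteq> set ts" for us
        using that
      proof (induction us)
        case (Cons u us)
        obtain c t where u: "u = (c, t)" by force
        have "(\<Sum>p\<leftarrow>map (\<lambda>(ws, vs). (c # ws, v # vs)) (leaf_paths t). prod_list (fst p)) =
            c * (\<Sum>p\<leftarrow>leaf_paths t. prod_list (fst p))"
          by (simp add: o_def case_prod_beta sum_list_const_mult)
        also have "\<dots> = c" using IH(1)[of c t] Cons.prems by (simp add: u)
        finally show ?case using Cons by (simp add: u)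
      qed simp
      then have "(\<Sum>p\<leftarrow>leaf_paths (Node v ts). prod_list (fst p)) = 1"
        using 1(2) False by simp
      moreover have "0 < prod_list (fst p) \<and> set (snd p) \<subseteq> set_wtree (Node v ts)"
        if "p \<in> set (leaf_paths (Node v ts))" for p
      proof -
        from that False obtain c t ws vs where *: "(c, t) \<in> set ts" "(ws, vs) \<in> set (leaf_paths t)"
          "p = (c # ws, v # vs)" by auto
        then have "0 < prod_list ws" "set vs \<subseteq> set_wtree t" "0 < c"
          using bspec[OF IH(2)[OF *(1)] *(2)] IH(3)[OF *(1)] by auto
        then show ?thesis using * by fastforce
      qed
      ultimately show ?thesis by blast
    qed simp
  qed
  then show "(\<Sum>p\<leftarrow>leaf_paths T. prod_list (fst p)) = 1"
    "p \<in> set (leaf_paths T) \<Longrightarrow> 0 < prod_list (fst p)"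
    "p \<in> set (leaf_paths T) \<Longrightarrow> set (snd p) \<subseteq> set_wtree T" by auto
qed

text \<open>The determinant is the product of the nonzero diagonal entries, so
  \<open>mat_inverse\<close> does not return \<open>None\<close>.\<close>

lemma mat_inv_lower_triangular:
  assumes A: "A \<in> carrier_mat n n"
    and lower: "\<And>i j. i < j \<Longrightarrow> j < n \<Longrightarrow> A $$ (i, j) = 0"
    and diag: "\<And>i. i < n \<Longrightarrow> A $$ (i, i) \<noteq> 0"
  shows "mat_inv A \<in> carrier_mat n n" "A * mat_inv A = 1\<^sub>m n"
proof -
  have "det A = prod_list (diag_mat A)"
    by (rule det_lower_triangular[OF lower A])
  also have "\<dots> \<noteq> 0"
    using diag A by (auto simp: diag_mat_def prod_list_zero_iff)
  finally have "A \<in> Units (ring_mat TYPE(complex) n ())"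
    by (rule det_non_zero_imp_unit[OF A])
  then obtain B where B: "mat_inverse A = Some B"
    using mat_inverse(1)[OF A, where b="()"] by (cases "mat_inverse A") auto
  from mat_inverse(2)[OF A this] B show "mat_inv A \<in> carrier_mat n n" "A * mat_inv A = 1\<^sub>m n"
    by (auto simp: mat_inv_def)
qed

section \<open>The matrices of the tree in coordinates\<close>

locale kaczmarz_tree =
  fixes d :: nat and T :: "'v wtree" and a :: "'v \<Rightarrow> complex vec" and b :: "'v \<Rightarrow> complex"
  assumes normalized: "normalized_weights T"
    and row_carrier: "\<And>v. v \<in> set_wtree T \<Longrightarrow> a v \<in> carrier_vec d"
    and node_nonzero: "\<And>v. v \<in> set_wtree T \<Longrightarrow> a v \<noteq> 0\<^sub>v d"
begin

definition "nodes = labelled_nodes 0 (leaf_paths T)"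
definition "N = length nodes"
definition "node r = snd (snd (nodes ! r))"
definition "leaf r = fst (nodes ! r)"
definition "leaf_weight i = prod_list (fst (leaf_paths T ! i))"
definition "row_entry r k = a (node r) $ k"

lemma node_props:
  assumes "r < N"
  shows "leaf r < length (leaf_paths T)" "fst (snd (nodes ! r)) = leaf_weight (leaf r)"
    "node r \<in> set_wtree T"
proof -
  have *: "(leaf r, fst (snd (nodes ! r)), node r) \<in> set (labelled_nodes 0 (leaf_paths T))"
    using assms by (simp add: N_def leaf_def node_def nodes_def)
  show "leaf r < length (leaf_paths T)" "fst (snd (nodes ! r)) = leaf_weight (leaf r)"
    using labelled_nodesD[OF *] by (auto simp: leaf_weight_def)
  then show "node r \<in> set_wtree T"
    using labelled_nodesD[OF *] leaf_paths_weights(3)[OF normalized nth_mem] by auto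
qed

sublocale weighted_sweeps N d "length (leaf_paths T)" row_entry leaf leaf_weight
proof
  show "(\<Sum>i<length (leaf_paths T). leaf_weight i) = 1"
    using leaf_paths_weights(1)[OF normalized]
    by (simp add: leaf_weight_def sum_list_sum_nth atLeast0LessThan)
  show "0 < leaf_weight i" if "i < length (leaf_paths T)" for i
    using leaf_paths_weights(2)[OF normalized nth_mem[OF that]] by (simp add: leaf_weight_def)
  show "leaf r < length (leaf_paths T)" if "r < N" for r
    by (rule node_props(1)[OF that])
  show "\<exists>k<d. row_entry r k \<noteq> 0" if "r < N" for r
  proof (rule ccontr)
    assume "\<not> (\<exists>k<d. row_entry r k \<noteq> 0)"
    then have "a (node r) = 0\<^sub>v d"
      using row_carrier[OF node_props(3)[OF that]] by (intro eq_vecI) (auto simp: row_entry_def)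
    with node_nonzero[OF node_props(3)[OF that]] show False by simp
  qed
qed

lemma inner_rows: "r < N \<Longrightarrow> s < N \<Longrightarrow> a (node r) \<bullet>c a (node s) = gram r s"
  using row_carrier[OF node_props(3), of r] row_carrier[OF node_props(3), of s]
  by (simp add: scalar_prod_def gram_def row_entry_def atLeast0LessThan)

lemma S_mat_eq: "S_mat d a T = mat N d (\<lambda>(r, k). row_entry r k)"
  unfolding S_mat_def concat_map_nodes[where n=0] mat_of_rows_def N_def row_entry_def node_def nodes_def
  by (rule eq_matI) (auto simp: case_prod_beta)

lemma b_vec_eq: "b_vec b T = vec N (\<lambda>r. b (node r))"
  unfolding b_vec_def concat_map_nodes[where n=0] N_def node_def nodes_def
  by (rule eq_vecI) (auto simp: case_prod_beta vec_of_list_index)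

lemma D_mat_eq: "D_mat a T = mat N N (\<lambda>(r, s). if r = s then of_real (diag r) else 0)"
proof -
  have "D_mat a T = mat N N (\<lambda>(r, s). if leaf r = leaf s then
      (if r = s then a (node r) \<bullet>c a (node s) else 0) else 0)"
    using diag_block_mat_labelled[where n=0 and ps="leaf_paths T" and
        h="\<lambda>x y i j. if i = j then a (snd x) \<bullet>c a (snd y) else 0", unfolded fst_conv snd_conv]
    unfolding D_mat_def D_leaf_def N_def node_def leaf_def nodes_def by simp
  also have "\<dots> = mat N N (\<lambda>(r, s). if r = s then of_real (diag r) else 0)"
    by (rule eq_matI) (auto simp: inner_rows gram_diag)
  finally show ?thesis .
qed

text \<open>Within one leaf the order of the rows is the order along the path, so the triangular
  condition can be tested on global row indices.\<close>

lemma L_mat_eq: "L_mat a T = mat N N (\<lambda>(r, s). if s < r then low r s else 0)"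
proof -
  have "L_mat a T = mat N N (\<lambda>(r, s). if leaf r = leaf s then
      (if s < r then a (node r) \<bullet>c a (node s) else 0) else 0)"
    using diag_block_mat_labelled[where n=0 and ps="leaf_paths T" and
        h="\<lambda>x y i j. if j < i then a (snd x) \<bullet>c a (snd y) else 0", unfolded fst_conv snd_conv]
    unfolding L_mat_def L_leaf_def N_def node_def leaf_def nodes_def by simp
  also have "\<dots> = mat N N (\<lambda>(r, s). if s < r then low r s else 0)"
    by (rule eq_matI) (auto simp: inner_rows low_def)
  finally show ?thesis .
qed

lemma W_mat_eq: "W_mat T = mat N N (\<lambda>(r, s). if r = s then of_real (wt r) else 0)"
proof -
  have "W_mat T = diag_block_mat (map (\<lambda>(ws, vs). mat (length vs) (length vs)
      (\<lambda>(i, j). if i = j then of_real (prod_list ws) else 0)) (leaf_paths T))"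
    unfolding W_mat_def
    by (intro arg_cong[where f=diag_block_mat] map_cong) (auto intro!: eq_matI)
  also have "\<dots> = mat N N (\<lambda>(r, s). if leaf r = leaf s then
      (if r = s then of_real (fst (snd (nodes ! r))) else 0) else 0)"
    using diag_block_mat_labelled[where n=0 and ps="leaf_paths T" and
        h="\<lambda>x y i j. if i = j then of_real (fst x) else 0", unfolded fst_conv snd_conv]
    unfolding N_def leaf_def nodes_def by simp
  also have "\<dots> = mat N N (\<lambda>(r, s). if r = s then of_real (wt r) else 0)"
    by (rule eq_matI) (auto simp: node_props wt_def)
  finally show ?thesis .
qed

lemma mult_W: "z \<in> carrier_vec N \<Longrightarrow> r < N \<Longrightarrow> (W_mat T *\<^sub>v z) $ r = of_real (wt r) * z $ r"
  by (simp add: W_mat_eq scalar_prod_def if_distrib[of "\<lambda>u. u * _"] sum.delta' cong: if_cong)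

lemma mult_S: "x \<in> carrier_vec d \<Longrightarrow> r < N \<Longrightarrow> (S_mat d a T *\<^sub>v x) $ r = app (\<lambda>k. x $ k) r"
  by (simp add: S_mat_eq scalar_prod_def app_def atLeast0LessThan)

lemma adjoint_S_eq: "mat_adjoint (S_mat d a T) = mat d N (\<lambda>(k, r). cnj (row_entry r k))"
  unfolding S_mat_eq mat_adjoint_def mat_of_rows_def by (rule eq_matI) auto

lemma mult_adjoint_S:
  "y \<in> carrier_vec N \<Longrightarrow> k < d \<Longrightarrow> (mat_adjoint (S_mat d a T) *\<^sub>v y) $ k = adj (\<lambda>r. y $ r) k"
  by (simp add: adjoint_S_eq scalar_prod_def adj_def atLeast0LessThan)

abbreviation "M \<omega> \<equiv> D_mat a T + complex_of_real \<omega> \<cdot>\<^sub>m L_mat a T"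

lemma M_inv: "mat_inv (M \<omega>) \<in> carrier_mat N N" "M \<omega> * mat_inv (M \<omega>) = 1\<^sub>m N"
  by (rule mat_inv_lower_triangular; use diag_pos in \<open>force simp: D_mat_eq L_mat_eq\<close>)+

lemma mult_M:
  assumes "y \<in> carrier_vec N" "r < N"
  shows "(M \<omega> *\<^sub>v y) $ r = of_real (diag r) * y $ r + of_real \<omega> * (\<Sum>s<r. low r s * y $ s)"
proof -
  have "(M \<omega> *\<^sub>v y) $ r =
      (\<Sum>s<N. ((if r = s then of_real (diag r) else 0) +
        of_real \<omega> * (if s < r then low r s else 0)) * y $ s)"
    using assms by (simp add: D_mat_eq L_mat_eq scalar_prod_def atLeast0LessThan)
  also have "\<dots> = (\<Sum>s<N. (if r = s then of_real (diag r) * y $ s else 0) +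
        of_real \<omega> * (if s < r then low r s * y $ s else 0))"
    by (intro sum.cong) (auto simp: algebra_simps)
  also have "\<dots> = of_real (diag r) * y $ r + of_real \<omega> * (\<Sum>s<N. if s < r then low r s * y $ s else 0)"
    using assms by (simp add: sum.distrib sum.delta sum_distrib_left)
  also have "(\<Sum>s<N. if s < r then low r s * y $ s else 0) = (\<Sum>s<r. low r s * y $ s)"
    using assms by (intro sum.mono_neutral_cong_right) auto
  finally show ?thesis .
qed

text \<open>\<open>M \<omega>\<close> couples only rows of the same leaf, where W is constant, so W
  commutes with the inverse. Concretely, the solution of M y = W z, divided entrywise by the
  weights, solves M v = z, and \<open>sol_unique\<close> applies.\<close>

lemma M_inv_W:
  assumes z: "z \<in> carrier_vec N" and "r < N"
  shows "((mat_inv (M \<omega>) * W_mat T) *\<^sub>v z) $ r = of_real (wt r) * sol \<omega> (\<lambda>r. z $ r) r"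
proof -
  have W: "W_mat T \<in> carrier_mat N N" by (simp add: W_mat_eq)
  have M: "M \<omega> \<in> carrier_mat N N" by (simp add: D_mat_eq L_mat_eq)
  define y where "y = (mat_inv (M \<omega>) * W_mat T) *\<^sub>v z"
  have y: "y \<in> carrier_vec N"
    unfolding y_def by (rule mult_mat_vec_carrier[OF mult_carrier_mat[OF M_inv(1) W] z])
  have "M \<omega> *\<^sub>v y = (M \<omega> * mat_inv (M \<omega>)) *\<^sub>v (W_mat T *\<^sub>v z)"
    unfolding y_def assoc_mult_mat_vec[OF M_inv(1) W z]
    using W z by (subst assoc_mult_mat_vec[OF M M_inv(1)]) auto
  then have My: "M \<omega> *\<^sub>v y = W_mat T *\<^sub>v z"
    using W z by (simp add: M_inv(2))
  have eq: "of_real (diag r) * y $ r + of_real \<omega> * (\<Sum>s<r. low r s * y $ s) = of_real (wt r) * z $ r"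
    if "r < N" for r
    using mult_M[OF y that, of \<omega>] mult_W[OF z that] by (simp add: My)
  have "y $ r / of_real (wt r) = sol \<omega> (\<lambda>r. z $ r) r"
  proof (rule sol_unique[OF _ \<open>r < N\<close>])
    fix r assume r: "r < N"
    \<comment> \<open>\<open>low r s\<close> vanishes unless both rows lie on the same leaf, where
      \<open>wt s = wt r\<close>.\<close>
    have "low r s * (y $ s / of_real (wt s)) = low r s * y $ s / of_real (wt r)" for s
      by (simp add: low_def wt_def)
    then have "(\<Sum>s<r. low r s * (y $ s / of_real (wt s))) =
        (\<Sum>s<r. low r s * y $ s) / of_real (wt r)"
      by (simp only: sum_divide_distrib)
    then have "of_real (diag r) * (y $ r / of_real (wt r)) +
        of_real \<omega> * (\<Sum>s<r. low r s * (y $ s / of_real (wt s))) =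
        (of_real (diag r) * y $ r + of_real \<omega> * (\<Sum>s<r. low r s * y $ s)) / of_real (wt r)"
      by (simp add: add_divide_distrib)
    also have "\<dots> = z $ r"
      using wt_pos[OF r] by (simp add: eq[OF r])
    finally show "of_real (diag r) * (y $ r / of_real (wt r)) +
        of_real \<omega> * (\<Sum>s<r. low r s * (y $ s / of_real (wt s))) = z $ r" .
  qed
  then show ?thesis using wt_pos[OF \<open>r < N\<close>] by (auto simp: y_def field_simps)
qed

section \<open>Matrix iterates as relaxation sequences\<close>

abbreviation "G \<omega> \<equiv> mat_adjoint (S_mat d a T) * mat_inv (M \<omega>) * W_mat T"

lemma G_carrier: "G \<omega> \<in> carrier_mat d N"
  by (intro mult_carrier_mat[where n=N] M_inv) (simp_all add: adjoint_S_eq W_mat_eq)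

lemma mult_G:
  assumes z: "z \<in> carrier_vec N" and "k < d"
  shows "(G \<omega> *\<^sub>v z) $ k = corr \<omega> (\<lambda>r. z $ r) k"
proof -
  have S: "mat_adjoint (S_mat d a T) \<in> carrier_mat d N" and W: "W_mat T \<in> carrier_mat N N"
    by (simp_all add: adjoint_S_eq W_mat_eq)
  have MW: "mat_inv (M \<omega>) * W_mat T \<in> carrier_mat N N"
    using M_inv(1)[of \<omega>] W by simp
  have "G \<omega> *\<^sub>v z = mat_adjoint (S_mat d a T) *\<^sub>v ((mat_inv (M \<omega>) * W_mat T) *\<^sub>v z)"
    by (simp only: assoc_mult_mat[OF S M_inv(1) W] assoc_mult_mat_vec[OF S MW z])
  also have "\<dots> $ k = adj (\<lambda>r. ((mat_inv (M \<omega>) * W_mat T) *\<^sub>v z) $ r) k"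
    using MW z \<open>k < d\<close> by (intro mult_adjoint_S) auto
  also have "\<dots> = corr \<omega> (\<lambda>r. z $ r) k"
    by (simp add: adj_def corr_def M_inv_W[OF z])
  finally show ?thesis .
qed

lemma range_S_adj_iff: "x \<in> range_S_adj d a T \<longleftrightarrow> x \<in> carrier_vec d \<and> in_range (\<lambda>k. x $ k)"
proof
  assume "x \<in> range_S_adj d a T"
  then obtain y where "y \<in> carrier_vec N" "x = mat_adjoint (S_mat d a T) *\<^sub>v y"
    by (auto simp: range_S_adj_def S_mat_eq)
  then show "x \<in> carrier_vec d \<and> in_range (\<lambda>k. x $ k)"
    using mult_adjoint_S
    by (auto simp: in_range_def adjoint_S_eq[THEN arg_cong[where f=dim_row]] intro!: carrier_vecI
        simp del: index_mult_mat_vec)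
next
  assume x: "x \<in> carrier_vec d \<and> in_range (\<lambda>k. x $ k)"
  then obtain y where y: "\<And>k. k < d \<Longrightarrow> x $ k = adj y k" by (auto simp: in_range_def)
  have "x = mat_adjoint (S_mat d a T) *\<^sub>v vec N y"
  proof (rule eq_vecI)
    fix k assume "k < dim_vec (mat_adjoint (S_mat d a T) *\<^sub>v vec N y)"
    then have "k < d" by (simp add: adjoint_S_eq)
    then show "x $ k = (mat_adjoint (S_mat d a T) *\<^sub>v vec N y) $ k"
      by (subst mult_adjoint_S) (simp_all add: y adj_def)
  qed (use x in \<open>simp add: adjoint_S_eq\<close>)
  then show "x \<in> range_S_adj d a T" by (auto simp: range_S_adj_def S_mat_eq)
qed

abbreviation "\<beta> r \<equiv> b (node r)"

text \<open>On the range \<open>B_hat\<close> acts as the full matrix, and regrouping turns the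
  affine step into x + \<omega> G (b - S x).\<close>

lemma kaczmarz_step:
  fixes \<omega> :: real
  assumes x: "x \<in> range_S_adj d a T"
  defines "x' \<equiv> B_hat d a T \<omega> x + b_relax d a b T \<omega>"
  shows "x' \<in> carrier_vec d"
    and "k < d \<Longrightarrow> x' $ k = x $ k + of_real \<omega> * corr \<omega> (\<lambda>r. \<beta> r - app (\<lambda>k. x $ k) r) k"
proof -
  have xd: "x \<in> carrier_vec d" using x by (simp add: range_S_adj_iff)
  have S: "S_mat d a T \<in> carrier_mat N d" by (simp add: S_mat_eq)
  have b: "b_vec b T \<in> carrier_vec N" by (simp add: b_vec_eq)
  have x': "x' = (1\<^sub>m d - complex_of_real \<omega> \<cdot>\<^sub>m (G \<omega> * S_mat d a T)) *\<^sub>v x +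
      complex_of_real \<omega> \<cdot>\<^sub>v (G \<omega> *\<^sub>v b_vec b T)"
    using x by (simp add: x'_def B_hat_def B_mat_def b_relax_def)
  have GS: "G \<omega> * S_mat d a T \<in> carrier_mat d d"
    by (rule mult_carrier_mat[OF G_carrier S])
  have Gb: "G \<omega> *\<^sub>v b_vec b T \<in> carrier_vec d"
    by (rule mult_mat_vec_carrier[OF G_carrier b])
  show "x' \<in> carrier_vec d"
    unfolding x' using GS Gb xd by (intro add_carrier_vec mult_mat_vec_carrier minus_carrier_mat) auto
  have Bx: "(1\<^sub>m d - complex_of_real \<omega> \<cdot>\<^sub>m (G \<omega> * S_mat d a T)) *\<^sub>v x =
      x - complex_of_real \<omega> \<cdot>\<^sub>v (G \<omega> *\<^sub>v (S_mat d a T *\<^sub>v x))"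
  proof -
    have "(complex_of_real \<omega> \<cdot>\<^sub>m (G \<omega> * S_mat d a T)) *\<^sub>v x =
        complex_of_real \<omega> \<cdot>\<^sub>v ((G \<omega> * S_mat d a T) *\<^sub>v x)"
      using GS xd by (intro eq_vecI) auto
    then show ?thesis
      using GS xd by (simp add: minus_mult_distrib_mat_vec[where nr=d and nc=d] assoc_mult_mat_vec[OF G_carrier S xd])
  qed
  assume k: "k < d"
  have Sx: "S_mat d a T *\<^sub>v x \<in> carrier_vec N" using S xd by simp
  have "corr \<omega> (\<lambda>r. \<beta> r - app (\<lambda>k. x $ k) r) k =
      corr \<omega> (\<lambda>r. b_vec b T $ r - (S_mat d a T *\<^sub>v x) $ r) k"
    by (rule fun_cong[OF corr_cong]) (simp add: mult_S[OF xd] b_vec_eq del: index_mult_mat_vec)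
  also have "\<dots> = (G \<omega> *\<^sub>v b_vec b T) $ k - (G \<omega> *\<^sub>v (S_mat d a T *\<^sub>v x)) $ k"
    by (simp only: corr_diff mult_G[OF b k] mult_G[OF Sx k])
  finally have c: "corr \<omega> (\<lambda>r. \<beta> r - app (\<lambda>k. x $ k) r) k =
      (G \<omega> *\<^sub>v b_vec b T) $ k - (G \<omega> *\<^sub>v (S_mat d a T *\<^sub>v x)) $ k" .
  have GSx: "G \<omega> *\<^sub>v (S_mat d a T *\<^sub>v x) \<in> carrier_vec d"
    by (rule mult_mat_vec_carrier[OF G_carrier Sx])
  have entry: "(x - e \<cdot>\<^sub>v u + e \<cdot>\<^sub>v v) $ k = x $ k + e * (v $ k - u $ k)"
    if "u \<in> carrier_vec d" "v \<in> carrier_vec d" for e u v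
    using that xd k by (simp add: right_diff_distrib)
  show "x' $ k = x $ k + of_real \<omega> * corr \<omega> (\<lambda>r. \<beta> r - app (\<lambda>k. x $ k) r) k"
    unfolding x' Bx c by (rule entry[OF GSx Gb])
qed

text \<open>Membership in the range is carried along the iteration, since \<open>B_hat\<close> is
  \<open>undefined\<close> outside it and the step formula applies only inside.\<close>

lemma kaczmarz_iter_relaxation:
  assumes "x0 \<in> range_S_adj d a T"
  shows "kaczmarz_iter d a b T \<omega> x0 n \<in> carrier_vec d"
    and "relaxation \<omega> \<beta> (\<lambda>n k. kaczmarz_iter d a b T \<omega> x0 n $ k)"
proof -
  have range: "kaczmarz_iter d a b T \<omega> x0 n \<in> range_S_adj d a T" for n
  proof (induction n)
    case (Suc n)
    let ?x = "kaczmarz_iter d a b T \<omega> x0 n"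
    have "in_range (\<lambda>k. ?x $ k + of_real \<omega> * corr \<omega> (\<lambda>r. \<beta> r - app (\<lambda>k. ?x $ k) r) k)"
      using Suc by (intro in_range_add_scaled in_range_corr) (simp add: range_S_adj_iff)
    then show ?case
      unfolding kaczmarz_iter.simps using kaczmarz_step[OF Suc]
      by (auto simp: range_S_adj_iff del: index_add_vec intro: in_range_cong)
  qed (simp add: assms)
  then show "kaczmarz_iter d a b T \<omega> x0 n \<in> carrier_vec d"
    by (simp add: range_S_adj_iff)
  show "relaxation \<omega> \<beta> (\<lambda>n k. kaczmarz_iter d a b T \<omega> x0 n $ k)"
    using range[of 0] kaczmarz_step(2)[OF range]
    by (simp add: relaxation_def range_S_adj_iff del: index_add_vec)
qed

lemma ls_functional_eq:
  assumes z: "z \<in> carrier_vec d"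
  shows "ls_functional d a b T z =
    (\<Sum>r<N. wt r / diag r * (cmod (\<beta> r - app (\<lambda>k. z $ k) r))\<^sup>2)"
proof -
  define e where "e = b_vec b T - S_mat d a T *\<^sub>v z"
  have e: "e \<in> carrier_vec N"
    by (simp add: e_def S_mat_eq carrier_vecI)
  have er: "e $ r = \<beta> r - app (\<lambda>k. z $ k) r" if "r < N" for r
    using that by (simp add: e_def mult_S[OF z] b_vec_eq S_mat_eq[THEN arg_cong[where f=dim_row]] del: index_mult_mat_vec)
  \<comment> \<open>D is the value of \<open>M\<close> at 0, so \<open>M_inv_W\<close> with \<omega>
    = 0 evaluates the weighted inverse of D; there \<open>sol 0\<close> is plain division by
    \<open>diag\<close>.\<close>
  have M0: "D_mat a T + 0 \<cdot>\<^sub>m L_mat a T = D_mat a T"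
    by (rule eq_matI) (auto simp: D_mat_eq L_mat_eq)
  have "((mat_inv (D_mat a T) * W_mat T) *\<^sub>v e) $ r = of_real (wt r / diag r) * e $ r" if "r < N" for r
    using M_inv_W[OF e that, of 0] by (subst (asm) sol.simps) (simp add: M0 del: index_mult_mat_vec)
  then have "((mat_inv (D_mat a T) * W_mat T) *\<^sub>v e) \<bullet>c e =
      (\<Sum>r<N. of_real (wt r / diag r) * (e $ r * cnj (e $ r)))"
    using e by (simp add: scalar_prod_def atLeast0LessThan mult.assoc del: index_mult_mat_vec)
  also have "\<dots> = of_real (\<Sum>r<N. wt r / diag r * (cmod (e $ r))\<^sup>2)"
    by (simp add: complex_norm_square del: of_real_power)
  finally show ?thesis
    unfolding ls_functional_def Let_def e_def[symmetric] using er by simp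
qed

end

theorem theorem14:
  fixes d :: nat
    and T :: "'v wtree"
    and a :: "'v \<Rightarrow> complex vec"
    and b :: "'v \<Rightarrow> complex"
  assumes "normalized_weights T"
    and "\<And>v. v \<in> set_wtree T \<Longrightarrow> a v \<in> carrier_vec d"
    and "\<And>v. v \<in> set_wtree T \<Longrightarrow> a v \<noteq> 0\<^sub>v d"
  shows "\<exists>x xLS.
    (\<forall>\<omega>\<in>{0<..<2}. x \<omega> \<in> carrier_vec d \<and>
       (\<forall>x0\<in>range_S_adj d a T.
          vec_tendsto (kaczmarz_iter d a b T \<omega> x0) (x \<omega>) sequentially)) \<and>
    vec_tendsto x xLS (at 0 within {0<..<2}) \<and>
    is_arg_min (ls_functional d a b T) (\<lambda>z. z \<in> carrier_vec d) xLS"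
proof -
  interpret kaczmarz_tree d T a b
    using assms by unfold_locales
  obtain x xs where x: "\<And>\<omega> X k. \<omega> \<in> {0<..<2} \<Longrightarrow> relaxation \<omega> \<beta> X \<Longrightarrow> k < d \<Longrightarrow>
      (\<lambda>n. X n k) \<longlonglongrightarrow> x \<omega> k"
    and xs: "\<And>k. k < d \<Longrightarrow> ((\<lambda>\<omega>. x \<omega> k) \<longlongrightarrow> xs k) (at 0 within {0<..<2})"
    and min: "\<And>z. (\<Sum>r<N. wt r / diag r * (cmod (\<beta> r - app xs r))\<^sup>2) \<le>
      (\<Sum>r<N. wt r / diag r * (cmod (\<beta> r - app z r))\<^sup>2)"
    using relaxation_limits[of \<beta>] by blast
  have "vec_tendsto (kaczmarz_iter d a b T \<omega> x0) (vec d (x \<omega>)) sequentially"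
    if "\<omega> \<in> {0<..<2}" "x0 \<in> range_S_adj d a T" for \<omega> x0
    using kaczmarz_iter_relaxation(1)[OF that(2)] x[OF that(1) kaczmarz_iter_relaxation(2)[OF that(2)]]
    by (simp add: vec_tendsto_def carrier_vecD)
  moreover have "vec_tendsto (\<lambda>\<omega>. vec d (x \<omega>)) (vec d xs) (at 0 within {0<..<2})"
    using xs by (simp add: vec_tendsto_def)
  moreover have "is_arg_min (ls_functional d a b T) (\<lambda>z. z \<in> carrier_vec d) (vec d xs)"
  proof -
    \<comment> \<open>\<open>app\<close> reads only coordinates below \<open>d\<close>, so
      minimality passes from the function \<open>xs\<close> to the vector built from it.\<close>
    have "app (\<lambda>k. vec d xs $ k) = app xs" by (simp add: app_def fun_eq_iff)
    then have "ls_functional d a b T (vec d xs) \<le> ls_functional d a b T z" if "z \<in> carrier_vec d" for z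
      using min[of "\<lambda>k. z $ k"] that by (simp add: ls_functional_eq)
    then show ?thesis by (auto simp: is_arg_min_linorder)
  qed
  ultimately show ?thesis
    by (intro exI[of _ "\<lambda>\<omega>. vec d (x \<omega>)"] exI[of _ "vec d xs"]) auto
qed

end
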